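(* Let $M$ be a countable $\omega$-categorical Ramsey structure, let $G=\mathrm{Aut}(M)$, let $W$ be a sort in $M^{eq}$, and let $F$ be a field. Suppose that $U<V\le F^W$ are closed, $G$-invariant subspaces of $F^W$ (with $U\neq V$). Then there is a finite $S\subseteq W$ and a $G_{(S)}$-invariant function $h\in V\setminus U$.
   Context: $F^W$ is the $F$-vector space of all functions $f:W\to F$, with the topology of pointwise convergence ($F$ discrete) and $G$-action $(gf)(w)=f(g^{-1}w)$. $G_{(S)}$ denotes the pointwise stabiliser of $S$ in $G$. $M^{eq}$: the imaginary elements of $M$, i.e. equivalence classes of $\emptyset$-definable equivalence relations $E$ on $\emptyset$-definable subsets $D\subseteq M^n$ ($n\in\mathbb{N}$); $G$ acts on $M^{eq}$. Up to interdefinability, a sort in $M^{eq}$ is the same as a finite union of $G$-orbits on $M^{eq}$ (for example $M^n$). $M$ countably infinite is $\omega$-categorical iff $\mathrm{Aut}(M)$ has finitely many orbits on $M^n$ for all $n$. A Ramsey structure is a countable Fraïssé structure $M$ (locally finite, every isomorphism between finite substructures extends to an automorphism of $M$) whose age (the class of finite structures embeddable in $M$) is a Ramsey class of rigid structures (i.e. with trivial automorphism group). A class $\mathcal{C}$ of finite structures is a Ramsey class if it is closed under isomorphisms and substructures and for all $k\in\mathbb{N}$ and $A\subseteq B\in\mathcal{C}$ there is $B\subseteq C\in\mathcal{C}$ such that for every $k$-colouring of the set $\binom{C}{A}$ of substructures of $C$ isomorphic to $A$ there is a copy $B'$ of $B$ in $C$ such that the colouring is constant on $\binom{B'}{A}$.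 *)

theory Defs
  imports "HOL-Analysis.Analysis"
begin

section \<open>First-order structures\<close>

record ('f, 'r) language =
  fsyms :: "'f set"
  farity :: "'f \<Rightarrow> nat"
  rsyms :: "'r set"
  rarity :: "'r \<Rightarrow> nat"

text \<open>Only the values of the interpretations on symbols of the language and on tuples over the
  universe, of the right length, are meaningful. No notion below depends on the other values.
  Constants are function symbols of arity 0. The universe may be empty.\<close>

record ('f, 'r, 'a) struct =
  univ :: "'a set"
  fint :: "'f \<Rightarrow> 'a list \<Rightarrow> 'a"
  rint :: "'r \<Rightarrow> 'a list \<Rightarrow> bool"

definition tuples :: "nat \<Rightarrow> 'a set \<Rightarrow> 'a list set" where
  "tuples n A = {xs. length xs = n \<and> set xs \<subseteq> A}"

definition fclosed :: "('f, 'r) language \<Rightarrow> ('f, 'r, 'a) struct \<Rightarrow> 'a set \<Rightarrow> bool" where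
  "fclosed L M X \<longleftrightarrow> (\<forall>f\<in>fsyms L. \<forall>xs\<in>tuples (farity L f) X. fint M f xs \<in> X)"

definition is_structure :: "('f, 'r) language \<Rightarrow> ('f, 'r, 'a) struct \<Rightarrow> bool" where
  "is_structure L M \<longleftrightarrow> fclosed L M (univ M)"

definition embedding ::
  "('f, 'r) language \<Rightarrow> ('f, 'r, 'a) struct \<Rightarrow> ('f, 'r, 'b) struct \<Rightarrow> ('a \<Rightarrow> 'b) \<Rightarrow> bool" where
  "embedding L A B h \<longleftrightarrow> h ` univ A \<subseteq> univ B \<and> inj_on h (univ A) \<and>
     (\<forall>f\<in>fsyms L. \<forall>xs\<in>tuples (farity L f) (univ A). h (fint A f xs) = fint B f (map h xs)) \<and>
     (\<forall>r\<in>rsyms L. \<forall>xs\<in>tuples (rarity L r) (univ A). rint A r xs \<longleftrightarrow> rint B r (map h xs))"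

definition isomorphism ::
  "('f, 'r) language \<Rightarrow> ('f, 'r, 'a) struct \<Rightarrow> ('f, 'r, 'b) struct \<Rightarrow> ('a \<Rightarrow> 'b) \<Rightarrow> bool" where
  "isomorphism L A B h \<longleftrightarrow> embedding L A B h \<and> h ` univ A = univ B"

definition isomorphic ::
  "('f, 'r) language \<Rightarrow> ('f, 'r, 'a) struct \<Rightarrow> ('f, 'r, 'b) struct \<Rightarrow> bool" where
  "isomorphic L A B \<longleftrightarrow> (\<exists>h. isomorphism L A B h)"

text \<open>Automorphisms are taken to be the identity outside the universe, so that they form a group
  under composition.\<close>

definition Aut :: "('f, 'r) language \<Rightarrow> ('f, 'r, 'a) struct \<Rightarrow> ('a \<Rightarrow> 'a) set" where
  "Aut L M = {g. isomorphism L M M g \<and> g permutes univ M}"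

definition substructure ::
  "('f, 'r) language \<Rightarrow> ('f, 'r, 'a) struct \<Rightarrow> ('f, 'r, 'a) struct \<Rightarrow> bool" where
  "substructure L A B \<longleftrightarrow> is_structure L A \<and> is_structure L B \<and> univ A \<subseteq> univ B \<and> embedding L A B id"

text \<open>The substructure of \<open>M\<close> with universe \<open>X\<close>, for \<open>X\<close> closed under the functions of \<open>M\<close>.\<close>

definition induced :: "('f, 'r, 'a) struct \<Rightarrow> 'a set \<Rightarrow> ('f, 'r, 'a) struct" where
  "induced M X = M\<lparr>univ := X\<rparr>"

definition subuniverse :: "('f, 'r) language \<Rightarrow> ('f, 'r, 'a) struct \<Rightarrow> 'a set \<Rightarrow> bool" where
  "subuniverse L M X \<longleftrightarrow> X \<subseteq> univ M \<and> fclosed L M X"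

definition locally_finite :: "('f, 'r) language \<Rightarrow> ('f, 'r, 'a) struct \<Rightarrow> bool" where
  "locally_finite L M \<longleftrightarrow> (\<forall>X. finite X \<and> X \<subseteq> univ M \<longrightarrow> finite (subuniverse L M hull X))"

definition oligomorphic :: "('f, 'r) language \<Rightarrow> ('f, 'r, 'a) struct \<Rightarrow> bool" where
  "oligomorphic L M \<longleftrightarrow>
     (\<forall>n. finite ((\<lambda>xs. {map g xs | g. g \<in> Aut L M}) ` tuples n (univ M)))"

text \<open>\<open>\<omega>\<close>-categoricity in its permutation group form (Ryll-Nardzewski).\<close>

definition omega_categorical :: "('f, 'r) language \<Rightarrow> ('f, 'r, 'a) struct \<Rightarrow> bool" where
  "omega_categorical L M \<longleftrightarrow>
     is_structure L M \<and> countable (univ M) \<and> infinite (univ M) \<and> oligomorphic L M"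


section \<open>Ramsey structures\<close>

definition Fraisse_structure :: "('f, 'r) language \<Rightarrow> ('f, 'r, 'a) struct \<Rightarrow> bool" where
  "Fraisse_structure L M \<longleftrightarrow> is_structure L M \<and> countable (univ M) \<and> locally_finite L M \<and>
     (\<forall>X Y h. subuniverse L M X \<and> finite X \<and> subuniverse L M Y \<and> finite Y \<and>
        isomorphism L (induced M X) (induced M Y) h \<longrightarrow>
        (\<exists>g\<in>Aut L M. \<forall>x\<in>X. g x = h x))"

text \<open>Classes of finite structures are represented by sets of structures with universe a finite
  set of natural numbers. Every finite structure is isomorphic to one of these, and every such
  structure has room for any finite extension, up to an isomorphism fixing it.\<close>

definition age :: "('f, 'r) language \<Rightarrow> ('f, 'r, 'a) struct \<Rightarrow> ('f, 'r, nat) struct set" where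
  "age L M = {A. is_structure L A \<and> finite (univ A) \<and> (\<exists>h. embedding L A M h)}"

text \<open>The set of (universes of) substructures of \<open>C\<close> isomorphic to \<open>A\<close>.\<close>

definition copies ::
  "('f, 'r) language \<Rightarrow> ('f, 'r, 'a) struct \<Rightarrow> ('f, 'r, 'b) struct \<Rightarrow> 'a set set" where
  "copies L C A = {X. subuniverse L C X \<and> isomorphic L (induced C X) A}"

definition Ramsey_class :: "('f, 'r) language \<Rightarrow> ('f, 'r, nat) struct set \<Rightarrow> bool" where
  "Ramsey_class L \<C> \<longleftrightarrow>
     (\<forall>A\<in>\<C>. is_structure L A \<and> finite (univ A)) \<and>
     (\<forall>A\<in>\<C>. \<forall>B. is_structure L B \<and> isomorphic L A B \<longrightarrow> B \<in> \<C>) \<and>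
     (\<forall>B\<in>\<C>. \<forall>A. substructure L A B \<longrightarrow> A \<in> \<C>) \<and>
     (\<forall>k. \<forall>B\<in>\<C>. \<forall>A. substructure L A B \<longrightarrow>
        (\<exists>C\<in>\<C>. substructure L B C \<and>
           (\<forall>c :: nat set \<Rightarrow> nat. c \<in> copies L C A \<rightarrow> {..<k} \<longrightarrow>
              (\<exists>B'\<in>copies L C B. c constant_on copies L (induced C B') A))))"

definition rigid :: "('f, 'r) language \<Rightarrow> ('f, 'r, 'a) struct \<Rightarrow> bool" where
  "rigid L A \<longleftrightarrow> Aut L A = {id}"

definition Ramsey_structure :: "('f, 'r) language \<Rightarrow> ('f, 'r, 'a) struct \<Rightarrow> bool" where
  "Ramsey_structure L M \<longleftrightarrow>
     Fraisse_structure L M \<and> Ramsey_class L (age L M) \<and> (\<forall>A\<in>age L M. rigid L A)"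


section \<open>Definable sets\<close>

datatype 'f tm = Var nat | Fn 'f "'f tm list"

datatype ('f, 'r) fm =
    Eq "'f tm" "'f tm"
  | Atom 'r "'f tm list"
  | Neg "('f, 'r) fm"
  | Conj "('f, 'r) fm" "('f, 'r) fm"
  | Ex nat "('f, 'r) fm"

primrec wf_tm :: "('f, 'r) language \<Rightarrow> 'f tm \<Rightarrow> bool" where
  "wf_tm L (Var i) \<longleftrightarrow> True"
| "wf_tm L (Fn f ts) \<longleftrightarrow> f \<in> fsyms L \<and> length ts = farity L f \<and> list_all id (map (wf_tm L) ts)"

primrec wf_fm :: "('f, 'r) language \<Rightarrow> ('f, 'r) fm \<Rightarrow> bool" where
  "wf_fm L (Eq s t) \<longleftrightarrow> wf_tm L s \<and> wf_tm L t"
| "wf_fm L (Atom r ts) \<longleftrightarrow> r \<in> rsyms L \<and> length ts = rarity L r \<and> list_all (wf_tm L) ts"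
| "wf_fm L (Neg \<phi>) \<longleftrightarrow> wf_fm L \<phi>"
| "wf_fm L (Conj \<phi> \<psi>) \<longleftrightarrow> wf_fm L \<phi> \<and> wf_fm L \<psi>"
| "wf_fm L (Ex i \<phi>) \<longleftrightarrow> wf_fm L \<phi>"

primrec fv_tm :: "'f tm \<Rightarrow> nat set" where
  "fv_tm (Var i) = {i}"
| "fv_tm (Fn f ts) = \<Union> (set (map fv_tm ts))"

primrec fv :: "('f, 'r) fm \<Rightarrow> nat set" where
  "fv (Eq s t) = fv_tm s \<union> fv_tm t"
| "fv (Atom r ts) = \<Union> (fv_tm ` set ts)"
| "fv (Neg \<phi>) = fv \<phi>"
| "fv (Conj \<phi> \<psi>) = fv \<phi> \<union> fv \<psi>"
| "fv (Ex i \<phi>) = fv \<phi> - {i}"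

primrec val :: "('f, 'r, 'a) struct \<Rightarrow> (nat \<Rightarrow> 'a) \<Rightarrow> 'f tm \<Rightarrow> 'a" where
  "val M e (Var i) = e i"
| "val M e (Fn f ts) = fint M f (map (val M e) ts)"

primrec sat :: "('f, 'r, 'a) struct \<Rightarrow> (nat \<Rightarrow> 'a) \<Rightarrow> ('f, 'r) fm \<Rightarrow> bool" where
  "sat M e (Eq s t) \<longleftrightarrow> val M e s = val M e t"
| "sat M e (Atom r ts) \<longleftrightarrow> rint M r (map (val M e) ts)"
| "sat M e (Neg \<phi>) \<longleftrightarrow> \<not> sat M e \<phi>"
| "sat M e (Conj \<phi> \<psi>) \<longleftrightarrow> sat M e \<phi> \<and> sat M e \<psi>"
| "sat M e (Ex i \<phi>) \<longleftrightarrow> (\<exists>x\<in>univ M. sat M (e(i := x)) \<phi>)"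

text \<open>\<open>D\<close> is a \<open>\<emptyset>\<close>-definable subset of \<open>M\<^sup>n\<close>. The assignment \<open>(!) xs\<close> is
  only evaluated at variables below \<open>n = length xs\<close>.\<close>

definition definable ::
  "('f, 'r) language \<Rightarrow> ('f, 'r, 'a) struct \<Rightarrow> nat \<Rightarrow> 'a list set \<Rightarrow> bool" where
  "definable L M n D \<longleftrightarrow> (\<exists>\<phi>. wf_fm L \<phi> \<and> fv \<phi> \<subseteq> {..<n} \<and>
     D = {xs \<in> tuples n (univ M). sat M ((!) xs) \<phi>})"

definition definable_equiv ::
  "('f, 'r) language \<Rightarrow> ('f, 'r, 'a) struct \<Rightarrow> nat \<Rightarrow> 'a list set \<Rightarrow>
   ('a list \<times> 'a list) set \<Rightarrow> bool" where
  "definable_equiv L M n D E \<longleftrightarrow> definable L M n D \<and> equiv D E \<and>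
     definable L M (n + n) ((\<lambda>(xs, ys). xs @ ys) ` E)"


section \<open>Imaginaries and sorts\<close>

definition meq :: "('f, 'r) language \<Rightarrow> ('f, 'r, 'a) struct \<Rightarrow> 'a list set set" where
  "meq L M = {w. \<exists>n D E. definable_equiv L M n D E \<and> w \<in> D // E}"

definition act :: "('a \<Rightarrow> 'a) \<Rightarrow> 'a list set \<Rightarrow> 'a list set" where
  "act g w = map g ` w"

definition meq_orbit ::
  "('f, 'r) language \<Rightarrow> ('f, 'r, 'a) struct \<Rightarrow> 'a list set \<Rightarrow> 'a list set set" where
  "meq_orbit L M w = {act g w | g. g \<in> Aut L M}"

text \<open>A sort is a finite union of orbits on the imaginaries. Every quotient of a definable set by
  a definable equivalence relation is one, see \<open>quotient_sort\<close>.\<close>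

definition meq_sort :: "('f, 'r) language \<Rightarrow> ('f, 'r, 'a) struct \<Rightarrow> 'a list set set \<Rightarrow> bool" where
  "meq_sort L M W \<longleftrightarrow> (\<exists>T. finite T \<and> T \<subseteq> meq L M \<and> W = \<Union> (meq_orbit L M ` T))"

definition pw_stabiliser ::
  "('f, 'r) language \<Rightarrow> ('f, 'r, 'a) struct \<Rightarrow> 'a list set set \<Rightarrow> ('a \<Rightarrow> 'a) set" where
  "pw_stabiliser L M S = {g \<in> Aut L M. \<forall>s\<in>S. act g s = s}"


section \<open>Function spaces\<close>

text \<open>\<open>F\<^sup>W\<close> is the set \<open>W \<rightarrow>\<^sub>E UNIV\<close> of functions with the value \<open>undefined\<close>
  outside \<open>W\<close>, as this is the underlying set of the library's product topology.\<close>

definition pointwise_topology :: "'w set \<Rightarrow> ('w \<Rightarrow> 'k) topology" where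
  "pointwise_topology W = product_topology (\<lambda>_. discrete_topology UNIV) W"

definition fun_subspace :: "'w set \<Rightarrow> ('w \<Rightarrow> 'k::field) set \<Rightarrow> bool" where
  "fun_subspace W V \<longleftrightarrow> V \<subseteq> W \<rightarrow>\<^sub>E UNIV \<and> (\<lambda>w\<in>W. 0) \<in> V \<and>
     (\<forall>f\<in>V. \<forall>g\<in>V. (\<lambda>w\<in>W. f w + g w) \<in> V) \<and>
     (\<forall>c. \<forall>f\<in>V. (\<lambda>w\<in>W. c * f w) \<in> V)"

definition fun_act ::
  "'a list set set \<Rightarrow> ('a \<Rightarrow> 'a) \<Rightarrow> ('a list set \<Rightarrow> 'k) \<Rightarrow> 'a list set \<Rightarrow> 'k" where
  "fun_act W g f = (\<lambda>w\<in>W. f (act (inv g) w))"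

definition invariant_set ::
  "'a list set set \<Rightarrow> ('a \<Rightarrow> 'a) set \<Rightarrow> ('a list set \<Rightarrow> 'k) set \<Rightarrow> bool" where
  "invariant_set W G V \<longleftrightarrow> (\<forall>g\<in>G. \<forall>f\<in>V. fun_act W g f \<in> V)"

definition invariant_fun ::
  "'a list set set \<Rightarrow> ('a \<Rightarrow> 'a) set \<Rightarrow> ('a list set \<Rightarrow> 'k) \<Rightarrow> bool" where
  "invariant_fun W G f \<longleftrightarrow> (\<forall>g\<in>G. fun_act W g f = f)"


section \<open>Quotients of definable sets are sorts\<close>

lemma Aut_embedding: "g \<in> Aut L M \<Longrightarrow> embedding L M M g"
  by (simp add: Aut_def isomorphism_def)

lemma Aut_permutes: "g \<in> Aut L M \<Longrightarrow> g permutes univ M"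
  by (simp add: Aut_def)

lemma val_in_univ:
  assumes "is_structure L M" "wf_tm L t" "\<And>i. i \<in> fv_tm t \<Longrightarrow> e i \<in> univ M"
  shows "val M e t \<in> univ M"
  using assms(2,3)
proof (induction t)
  case (Fn f ts)
  have "val M e t \<in> univ M" if "t \<in> set ts" for t
    by (rule Fn.IH[OF that]) (use that Fn.prems in \<open>auto simp: list_all_iff\<close>)
  then have "map (val M e) ts \<in> tuples (farity L f) (univ M)"
    using Fn.prems(1) by (auto simp: tuples_def)
  with assms(1) Fn.prems show ?case by (auto simp: is_structure_def fclosed_def)
qed auto

lemma val_Aut:
  assumes "is_structure L M" "g \<in> Aut L M" "wf_tm L t"
    and "\<And>i. i \<in> fv_tm t \<Longrightarrow> e i \<in> univ M" "\<And>i. i \<in> fv_tm t \<Longrightarrow> e' i = g (e i)"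
  shows "val M e' t = g (val M e t)"
  using assms(3-5)
proof (induction t)
  case (Fn f ts)
  have *: "val M e t \<in> univ M" if "t \<in> set ts" for t
    by (rule val_in_univ[OF assms(1)]) (use that Fn.prems in \<open>auto simp: list_all_iff\<close>)
  then have "map (val M e) ts \<in> tuples (farity L f) (univ M)"
    using Fn.prems(1) by (auto simp: tuples_def)
  then have "g (fint M f (map (val M e) ts)) = fint M f (map g (map (val M e) ts))"
    using Aut_embedding[OF assms(2)] Fn.prems(1) by (auto simp: embedding_def)
  moreover have "val M e' t = g (val M e t)" if "t \<in> set ts" for t
    by (rule Fn.IH[OF that]) (use that Fn.prems in \<open>auto simp: list_all_iff\<close>)
  then have "map (val M e') ts = map g (map (val M e) ts)"
    by simp
  ultimately show ?case by (simp only: val.simps)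
qed auto

lemma sat_Aut:
  assumes "is_structure L M" "g \<in> Aut L M" "wf_fm L \<phi>"
    and "\<And>i. i \<in> fv \<phi> \<Longrightarrow> e i \<in> univ M" "\<And>i. i \<in> fv \<phi> \<Longrightarrow> e' i = g (e i)"
  shows "sat M e' \<phi> \<longleftrightarrow> sat M e \<phi>"
  using assms(3-5)
proof (induction \<phi> arbitrary: e e')
  case (Eq s t)
  have "val M e' s = g (val M e s)" "val M e' t = g (val M e t)"
    by (rule val_Aut[OF assms(1,2)]; use Eq in simp)+
  moreover have "inj g" using Aut_permutes[OF assms(2)] by (rule permutes_inj)
  ultimately show ?case by (simp add: inj_eq)
next
  case (Atom r ts)
  have *: "val M e t \<in> univ M" if "t \<in> set ts" for t
    by (rule val_in_univ[OF assms(1)]) (use that Atom.prems in \<open>auto simp: list_all_iff\<close>)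
  then have 1: "map (val M e) ts \<in> tuples (rarity L r) (univ M)"
    using Atom.prems(1) by (auto simp: tuples_def)
  have "val M e' t = g (val M e t)" if "t \<in> set ts" for t
    by (rule val_Aut[OF assms(1,2)]) (use that Atom.prems in \<open>auto simp: list_all_iff\<close>)
  then have "map (val M e') ts = map g (map (val M e) ts)"
    by simp
  moreover have "rint M r (map (val M e) ts) \<longleftrightarrow> rint M r (map g (map (val M e) ts))"
    using 1 Aut_embedding[OF assms(2)] Atom.prems(1) unfolding embedding_def by simp
  ultimately show ?case by (simp only: sat.simps)
next
  case (Neg \<phi>)
  have "sat M e' \<phi> \<longleftrightarrow> sat M e \<phi>" by (rule Neg.IH) (use Neg.prems in auto)
  then show ?case by simp
next
  case (Conj \<phi> \<psi>)
  have "sat M e' \<phi> \<longleftrightarrow> sat M e \<phi>" by (rule Conj.IH) (use Conj.prems in auto)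
  moreover have "sat M e' \<psi> \<longleftrightarrow> sat M e \<psi>" by (rule Conj.IH) (use Conj.prems in auto)
  ultimately show ?case by simp
next
  case (Ex i \<phi>)
  have "sat M (e'(i := g x)) \<phi> \<longleftrightarrow> sat M (e(i := x)) \<phi>" if "x \<in> univ M" for x
    by (rule Ex.IH) (use that Ex.prems in auto)
  then have "(\<exists>y\<in>g ` univ M. sat M (e'(i := y)) \<phi>) \<longleftrightarrow> (\<exists>x\<in>univ M. sat M (e(i := x)) \<phi>)"
    by blast
  moreover have "g ` univ M = univ M"
    using Aut_permutes[OF assms(2)] by (rule permutes_image)
  ultimately show ?case by (simp only: sat.simps)
qed

lemma definable_subset: "definable L M n D \<Longrightarrow> D \<subseteq> tuples n (univ M)"
  by (auto simp: definable_def)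

lemma definable_Aut:
  assumes "is_structure L M" "g \<in> Aut L M" "definable L M n D" "xs \<in> tuples n (univ M)"
  shows "map g xs \<in> D \<longleftrightarrow> xs \<in> D"
proof -
  obtain \<phi> where \<phi>: "wf_fm L \<phi>" "fv \<phi> \<subseteq> {..<n}" "D = {xs \<in> tuples n (univ M). sat M ((!) xs) \<phi>}"
    using assms(3) by (auto simp: definable_def)
  have xs: "length xs = n" "set xs \<subseteq> univ M" using assms(4) by (auto simp: tuples_def)
  have "sat M ((!) (map g xs)) \<phi> \<longleftrightarrow> sat M ((!) xs) \<phi>"
    by (rule sat_Aut[OF assms(1,2) \<phi>(1)]) (use \<phi>(2) xs nth_mem in \<open>auto dest!: subsetD[OF \<phi>(2)]\<close>)
  moreover have "map g xs \<in> tuples n (univ M)"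
    using xs Aut_permutes[OF assms(2)] by (auto simp: tuples_def permutes_in_image)
  ultimately show ?thesis using \<phi>(3) assms(4) by simp
qed

lemma definable_equiv_Aut:
  assumes "is_structure L M" "g \<in> Aut L M" "definable_equiv L M n D E"
    and "xs \<in> tuples n (univ M)" "ys \<in> tuples n (univ M)"
  shows "(map g xs, map g ys) \<in> E \<longleftrightarrow> (xs, ys) \<in> E"
proof -
  have D: "D \<subseteq> tuples n (univ M)" and E: "E \<subseteq> D \<times> D"
    and d: "definable L M (n + n) ((\<lambda>(xs, ys). xs @ ys) ` E)"
    using assms(3) definable_subset[of L M n D] by (auto simp: definable_equiv_def equiv_def)
  have *: "(us, vs) \<in> E \<longleftrightarrow> us @ vs \<in> (\<lambda>(xs, ys). xs @ ys) ` E" if "length us = n" for us vs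
  proof
    assume "us @ vs \<in> (\<lambda>(xs, ys). xs @ ys) ` E"
    then obtain us' vs' where 1: "(us', vs') \<in> E" "us @ vs = us' @ vs'" by auto
    then have "length us' = n" using D E by (auto simp: tuples_def)
    with 1 that show "(us, vs) \<in> E" by simp
  qed force
  have "xs @ ys \<in> tuples (n + n) (univ M)" using assms(4,5) by (auto simp: tuples_def)
  from definable_Aut[OF assms(1,2) d this] show ?thesis
    using *[of xs ys] *[of "map g xs" "map g ys"] assms(4) by (simp add: tuples_def)
qed

lemma act_class:
  assumes "is_structure L M" "g \<in> Aut L M" "definable_equiv L M n D E" "xs \<in> D"
  shows "act g (E `` {xs}) = E `` {map g xs}"
proof -
  have D: "D \<subseteq> tuples n (univ M)" and E: "E \<subseteq> D \<times> D"
    using assms(3) definable_subset[of L M n D] by (auto simp: definable_equiv_def equiv_def)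
  have perm: "g permutes univ M" using Aut_permutes[OF assms(2)] .
  show ?thesis
  proof (intro equalityI subsetI)
    fix v assume "v \<in> act g (E `` {xs})"
    then obtain ys where ys: "v = map g ys" "(xs, ys) \<in> E" by (auto simp: act_def)
    with D E have "xs \<in> tuples n (univ M)" "ys \<in> tuples n (univ M)" by auto
    then show "v \<in> E `` {map g xs}"
      using definable_equiv_Aut[OF assms(1-3)] ys by auto
  next
    fix v assume "v \<in> E `` {map g xs}"
    then have v: "(map g xs, v) \<in> E" by simp
    then have v': "v \<in> tuples n (univ M)" using D E by auto
    define ys where "ys = map (inv g) v"
    have 1: "v = map g ys"
      using permutes_inverses(1)[OF perm] by (simp add: ys_def o_def)
    have "ys \<in> tuples n (univ M)"
      using v' permutes_in_image[OF permutes_inv[OF perm]] by (auto simp: ys_def tuples_def)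
    then have "(xs, ys) \<in> E"
      using definable_equiv_Aut[OF assms(1-3), of xs ys] D assms(4) v 1 by auto
    then show "v \<in> act g (E `` {xs})" using 1 by (auto simp: act_def)
  qed
qed

theorem quotient_sort:
  assumes "omega_categorical L M" "definable_equiv L M n D E"
  shows "meq_sort L M (D // E)"
proof -
  have str: "is_structure L M" and oli: "oligomorphic L M"
    using assms(1) by (auto simp: omega_categorical_def)
  have D: "D \<subseteq> tuples n (univ M)" "definable L M n D"
    using assms(2) definable_subset[of L M n D] by (auto simp: definable_equiv_def)
  define orb where "orb xs = {map g xs | g. g \<in> Aut L M}" for xs :: "'c list"
  have "finite (orb ` tuples n (univ M))"
    using oli by (simp add: oligomorphic_def orb_def)
  then have "finite (orb ` D)" using D(1) by (meson finite_subset image_mono)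
  then obtain T where T: "T \<subseteq> D" "finite T" "orb ` D = orb ` T"
    by (metis finite_subset_image subset_refl)
  have id: "id \<in> Aut L M"
    by (simp add: Aut_def isomorphism_def embedding_def permutes_id)
  define T' where "T' = (\<lambda>xs. E `` {xs}) ` T"
  have "T' \<subseteq> meq L M"
  proof
    fix w assume "w \<in> T'"
    then have "w \<in> D // E" using T(1) by (auto simp: T'_def intro: quotientI)
    then show "w \<in> meq L M" using assms(2) unfolding meq_def by blast
  qed
  moreover have "D // E = \<Union> (meq_orbit L M ` T')"
  proof (intro equalityI subsetI)
    fix w assume "w \<in> D // E"
    then obtain xs where xs: "xs \<in> D" "w = E `` {xs}" by (auto simp: quotient_def)
    then obtain ts where ts: "ts \<in> T" "orb xs = orb ts" using T(3) by blast
    have "map id xs \<in> orb xs" using id unfolding orb_def by blast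
    then have "xs \<in> orb ts" using ts by simp
    then obtain g where g: "g \<in> Aut L M" "xs = map g ts" by (auto simp: orb_def)
    then have "w = act g (E `` {ts})"
      using act_class[OF str g(1) assms(2)] ts T(1) xs by auto
    then show "w \<in> \<Union> (meq_orbit L M ` T')"
      using g ts by (auto simp: T'_def meq_orbit_def)
  next
    fix w assume "w \<in> \<Union> (meq_orbit L M ` T')"
    then obtain ts g where g: "ts \<in> T" "g \<in> Aut L M" "w = act g (E `` {ts})"
      by (auto simp: T'_def meq_orbit_def)
    then have "ts \<in> D" using T(1) by auto
    then have "w = E `` {map g ts}" "map g ts \<in> D"
      using act_class[OF str g(2) assms(2)] g definable_Aut[OF str g(2) D(2)] D(1) by auto
    then show "w \<in> D // E" by (auto simp: quotient_def)
  qed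
  ultimately show ?thesis
    using T(2) unfolding meq_sort_def T'_def by blast
qed

end

theory Submission
  imports Defs "HOL-Library.Function_Algebras"
begin

text \<open>Separate a function \<open>v\<close> in \<open>V - U\<close> from \<open>U\<close> by a finitely supported functional \<open>a\<close>,
  and let \<open>S\<close> be its support. If no \<open>G\<^bsub>(S)\<^esub>\<close>-invariant \<open>h\<close> in \<open>V\<close> has \<open>\<langle>h, a\<rangle> = 1\<close>, then by
  duality \<open>a\<close> agrees on \<open>V\<close> with a finite combination \<open>\<Sum>\<^sub>i c\<^sub>i (g\<^sub>i w\<^sub>i - w\<^sub>i)\<close> with \<open>g\<^sub>i\<close> in
  \<open>G\<^bsub>(S)\<^esub>\<close>. An additive character of the field into the circle yields a colouring of the field
  in finitely many colours such that \<open>\<Sum>\<^sub>i c\<^sub>i (x\<^sub>i - y\<^sub>i) = 1\<close> is impossible if \<open>x\<^sub>i\<close> and \<open>y\<^sub>i\<close> always have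
  the same colour; this replaces compactness of \<open>F\<^sup>W\<close>, which fails for infinite fields. The
  Ramsey property, which passes from \<open>G\<close> to its open subgroup \<open>G\<^bsub>(S)\<^esub>\<close>, moves \<open>v\<close> within its
  \<open>G\<^bsub>(S)\<^esub>\<close>-orbit to a function for which the values at \<open>g\<^sub>i w\<^sub>i\<close> and \<open>w\<^sub>i\<close> do have the same colour.\<close>

section \<open>Additive characters and colourings\<close>

text \<open>Graphs of partial homomorphisms into \<open>\<real> / \<int>\<close>, which extend to all elements because
  \<open>\<real> / \<int>\<close> is divisible.\<close>

definition circle_graph :: "('g::ring_1 \<times> real) set \<Rightarrow> bool" where
  "circle_graph \<Gamma> \<longleftrightarrow> (\<forall>p\<in>\<Gamma>. \<forall>q\<in>\<Gamma>. p - q \<in> \<Gamma>) \<and> (\<forall>r. (0, r) \<in> \<Gamma> \<longleftrightarrow> r \<in> \<int>)"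

section \<open>Partial characters into the circle, handled through their graphs\<close>

lemma circle_graph_diff: "circle_graph \<Gamma> \<Longrightarrow> p \<in> \<Gamma> \<Longrightarrow> q \<in> \<Gamma> \<Longrightarrow> p - q \<in> \<Gamma>"
  by (auto simp: circle_graph_def)

lemma circle_graph_zero: "circle_graph \<Gamma> \<Longrightarrow> 0 \<in> \<Gamma>"
  by (auto simp: circle_graph_def zero_prod_def)

lemma circle_graph_add:
  assumes "circle_graph \<Gamma>" "p \<in> \<Gamma>" "q \<in> \<Gamma>"
  shows "p + q \<in> \<Gamma>"
proof -
  have "0 - q \<in> \<Gamma>" using assms circle_graph_diff circle_graph_zero by blast
  then have "p - (0 - q) \<in> \<Gamma>" using assms circle_graph_diff by blast
  then show ?thesis by simp
qed

lemma circle_graph_multiple: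
  assumes "circle_graph \<Gamma>" "(x, r) \<in> \<Gamma>"
  shows "(of_int m * x, of_int m * r) \<in> \<Gamma>"
proof (induction m rule: int_induct[where k = 0])
  case base
  then show ?case using circle_graph_zero[OF assms(1)] by (simp add: zero_prod_def)
next
  case (step1 i)
  from circle_graph_add[OF assms(1) this(2) assms(2)] show ?case by (simp add: algebra_simps)
next
  case (step2 i)
  from circle_graph_diff[OF assms(1) this(2) assms(2)] show ?case by (simp add: algebra_simps)
qed

text \<open>Adjoining all integer multiples of \<open>(x, t)\<close> keeps closure under
  differences. The condition on \<open>t\<close> says that \<open>t\<close> is compatible, modulo
  integers, with the values already assigned to multiples of \<open>x\<close>, so no new value
  appears over \<open>0\<close>.\<close>

lemma circle_graph_extend:
  fixes x :: "'g::ring_1"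
  assumes \<Gamma>: "circle_graph \<Gamma>"
    and t: "\<And>m y r. (y, r) \<in> \<Gamma> \<Longrightarrow> y = of_int m * x \<Longrightarrow> r - of_int m * t \<in> \<int>"
  obtains \<Gamma>' where "circle_graph \<Gamma>'" "\<Gamma> \<subseteq> \<Gamma>'" "(x, t) \<in> \<Gamma>'"
proof
  define \<Gamma>' where "\<Gamma>' = {(y + of_int m * x, r + of_int m * t) | m y r. (y, r) \<in> \<Gamma>}"
  have I: "(y + of_int m * x, r + of_int m * t) \<in> \<Gamma>'" if "(y, r) \<in> \<Gamma>" for m y r
    using that unfolding \<Gamma>'_def by blast
  show sub: "\<Gamma> \<subseteq> \<Gamma>'" using I[of _ _ 0] by auto
  show "(x, t) \<in> \<Gamma>'"
    using I[of 0 0 1] circle_graph_zero[OF \<Gamma>] by (simp add: zero_prod_def)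
  show "circle_graph \<Gamma>'"
    unfolding circle_graph_def
  proof (intro conjI ballI allI)
    fix p q assume "p \<in> \<Gamma>'" "q \<in> \<Gamma>'"
    then obtain m y r m' y' r' where
      p: "(y, r) \<in> \<Gamma>" "p = (y + of_int m * x, r + of_int m * t)" and
      q: "(y', r') \<in> \<Gamma>" "q = (y' + of_int m' * x, r' + of_int m' * t)"
      unfolding \<Gamma>'_def by blast
    have "(y - y', r - r') \<in> \<Gamma>"
      using circle_graph_diff[OF \<Gamma> p(1) q(1)] by simp
    from I[OF this, of "m - m'"] show "p - q \<in> \<Gamma>'"
      by (simp add: p(2) q(2) algebra_simps)
  next
    fix r :: real
    show "(0, r) \<in> \<Gamma>' \<longleftrightarrow> r \<in> \<int>"
    proof
      assume "(0, r) \<in> \<Gamma>'"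
      then obtain m y r' where 1: "(y, r') \<in> \<Gamma>" "y + of_int m * x = 0" "r = r' + of_int m * t"
        unfolding \<Gamma>'_def by auto
      then have "y = of_int (- m) * x" by (simp add: eq_neg_iff_add_eq_0)
      from t[OF 1(1) this] show "r \<in> \<int>" using 1(3) by simp
    next
      assume "r \<in> \<int>"
      then have "(0, r) \<in> \<Gamma>" using \<Gamma> by (auto simp: circle_graph_def)
      with sub show "(0, r) \<in> \<Gamma>'" by blast
    qed
  qed
qed

text \<open>This is where divisibility of the circle enters: an \<open>n\<close>-th part of the
  value at \<open>n\<close> times \<open>x\<close> is an admissible value at \<open>x\<close>.
  Euclidean division and minimality of \<open>n\<close> show that a multiple of \<open>x\<close>
  lies in the domain only if its multiplier is divisible by \<open>n\<close>.\<close>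

lemma circle_graph_value:
  fixes x :: "'g::ring_1"
  assumes \<Gamma>: "circle_graph \<Gamma>"
    and n: "n > 0" "(of_nat n * x, s) \<in> \<Gamma>"
    and least: "\<And>n' s'. 0 < n' \<Longrightarrow> n' < n \<Longrightarrow> (of_nat n' * x, s') \<notin> \<Gamma>"
    and y: "(y, r) \<in> \<Gamma>" "y = of_int m * x"
  shows "r - of_int m * (s / real n) \<in> \<int>"
proof -
  define q where "q = m div int n"
  define k where "k = nat (m mod int n)"
  have m: "m = q * int n + int k"
    using n(1) by (simp add: q_def k_def)
  have k: "k < n" using n(1) by (simp add: k_def nat_less_iff)
  have "(of_int q * (of_nat n * x), of_int q * s) \<in> \<Gamma>"
    using circle_graph_multiple[OF \<Gamma> n(2)] .
  from circle_graph_diff[OF \<Gamma> y(1) this] have 1: "(of_nat k * x, r - of_int q * s) \<in> \<Gamma>"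
    by (simp add: y(2) m algebra_simps)
  then have "k = 0" using least[of k] k by blast
  with 1 have "r - of_int q * s \<in> \<int>" using \<Gamma> by (simp add: circle_graph_def)
  moreover have "of_int m * (s / real n) = of_int q * s"
    using n(1) \<open>k = 0\<close> by (simp add: m)
  ultimately show ?thesis by simp
qed

text \<open>An admissible value at \<open>x\<close> would extend the graph, so maximality forces
  \<open>x\<close> into the domain. If some positive multiple of \<open>x\<close> is in the domain,
  the value is found by division; otherwise only the multiplier \<open>0\<close> imposes a condition
  and the value \<open>0\<close> will do.\<close>

lemma circle_graph_total:
  fixes x :: "'g::ring_1"
  assumes \<Gamma>: "circle_graph \<Gamma>"
    and max: "\<And>\<Gamma>'. circle_graph \<Gamma>' \<Longrightarrow> \<Gamma> \<subseteq> \<Gamma>' \<Longrightarrow> \<Gamma>' = \<Gamma>"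
  shows "\<exists>t. (x, t) \<in> \<Gamma>"
proof -
  have "\<exists>t. \<forall>m y r. (y, r) \<in> \<Gamma> \<longrightarrow> y = of_int m * x \<longrightarrow> r - of_int m * t \<in> \<int>"
  proof (cases "\<exists>n>0. \<exists>s. (of_nat n * x, s) \<in> \<Gamma>")
    case True
    define n where "n = (LEAST n. n > 0 \<and> (\<exists>s. (of_nat n * x, s) \<in> \<Gamma>))"
    have "n > 0 \<and> (\<exists>s. (of_nat n * x, s) \<in> \<Gamma>)"
      unfolding n_def by (rule LeastI_ex) (use True in blast)
    then obtain s where n: "n > 0" "(of_nat n * x, s) \<in> \<Gamma>" by blast
    have least: "(of_nat n' * x, s') \<notin> \<Gamma>" if "0 < n'" "n' < n" for n' s'
      using not_less_Least[of n'] that unfolding n_def by blast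
    show ?thesis
      by (intro exI[of _ "s / real n"] allI impI) (rule circle_graph_value[OF \<Gamma> n least])
  next
    case False
    have "r - of_int m * 0 \<in> \<int>" if mr: "(of_int m * x, r) \<in> \<Gamma>" for m r
    proof -
      have "(of_int (sgn m) * (of_int m * x), of_int (sgn m) * r) \<in> \<Gamma>"
        by (rule circle_graph_multiple[OF \<Gamma> mr])
      moreover have "of_int (sgn m) * (of_int m * x) = of_nat (nat \<bar>m\<bar>) * x"
        by (cases m "0 :: int" rule: linorder_cases) auto
      ultimately have "(of_nat (nat \<bar>m\<bar>) * x, of_int (sgn m) * r) \<in> \<Gamma>" by simp
      with False have "nat \<bar>m\<bar> = 0" by (meson gr0I)
      then show ?thesis using mr \<Gamma> by (simp add: circle_graph_def)
    qed
    then show ?thesis by (intro exI[of _ 0]) blast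
  qed
  then obtain t where t: "\<And>m y r. (y, r) \<in> \<Gamma> \<Longrightarrow> y = of_int m * x \<Longrightarrow> r - of_int m * t \<in> \<int>"
    by blast
  obtain \<Gamma>' where "circle_graph \<Gamma>'" "\<Gamma> \<subseteq> \<Gamma>'" "(x, t) \<in> \<Gamma>'"
    by (rule circle_graph_extend[OF \<Gamma> t])
  with max show ?thesis by blast
qed

text \<open>The trivial character on \<open>{0}\<close> is first extended to the multiples of
  \<open>z\<close> with a non-integer value at \<open>z\<close>, then by Zorn's lemma, among graphs
  that keep this value, to everything. \<open>\<psi>\<close> picks real representatives of points of
  the circle, hence is additive only modulo integers.\<close>

lemma additive_character_exists:
  fixes z :: "'g::ring_1"
  assumes "z \<noteq> 0"
  obtains \<psi> :: "'g \<Rightarrow> real"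
  where "\<And>x y. \<psi> (x + y) - (\<psi> x + \<psi> y) \<in> \<int>" "\<psi> z \<notin> \<int>"
proof -
  define \<Gamma>\<^sub>0 :: "('g \<times> real) set" where "\<Gamma>\<^sub>0 = {0} \<times> \<int>"
  have \<Gamma>\<^sub>0: "circle_graph \<Gamma>\<^sub>0" by (auto simp: circle_graph_def \<Gamma>\<^sub>0_def)
  have "\<exists>t. t \<notin> \<int> \<and> (\<forall>m y r. (y, r) \<in> \<Gamma>\<^sub>0 \<longrightarrow> y = of_int m * z \<longrightarrow> r - of_int m * t \<in> \<int>)"
  proof (cases "\<exists>n>0. of_nat n * z = 0")
    case True
    define n where "n = (LEAST n. n > 0 \<and> of_nat n * z = 0)"
    have n: "n > 0 \<and> of_nat n * z = 0"
      unfolding n_def by (rule LeastI_ex) (use True in blast)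
    have "of_nat n' * z \<noteq> 0" if "0 < n'" "n' < n" for n'
      using not_less_Least[of n'] that unfolding n_def by blast
    \<comment> \<open>Modulo integers the value of \<open>of_nat n * z = 0\<close> may be taken to
      be \<open>1\<close> instead of \<open>0\<close>; its \<open>n\<close>-th part is then not an
      integer, as \<open>n > 1\<close>.\<close>
    then have "r - of_int m * (1 / real n) \<in> \<int>" if "(y, r) \<in> \<Gamma>\<^sub>0" "y = of_int m * z" for m y r
      using circle_graph_value[OF \<Gamma>\<^sub>0, of n z 1, OF _ _ _ that] n by (auto simp: \<Gamma>\<^sub>0_def)
    moreover have "n \<noteq> 1" using n assms by auto
    with n have "n > 1" by linarith
    then have "0 < 1 / real n" "1 / real n < 1" by simp_all
    then have "1 / real n \<notin> \<int>" using frac_eq_0_iff[of "1 / real n"] frac_eq[of "1 / real n"] by simp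
    ultimately show ?thesis by blast
  next
    case False
    \<comment> \<open>For \<open>z\<close> of infinite additive order, any non-integer is admissible
      as the value at \<open>z\<close>; \<open>1 / 2\<close> is chosen.\<close>
    have "m = 0" if "of_int m * z = 0" for m
    proof (rule ccontr)
      assume "m \<noteq> 0"
      then have "nat \<bar>m\<bar> > 0" by simp
      then have "of_nat (nat \<bar>m\<bar>) * z \<noteq> 0" using False by blast
      then show False using that by (cases "m \<ge> 0") simp_all
    qed
    then have "r - of_int m * (1 / 2) \<in> \<int>" if "(y, r) \<in> \<Gamma>\<^sub>0" "y = of_int m * z" for m y r
      using that by (force simp: \<Gamma>\<^sub>0_def)
    moreover have "(1 / 2 :: real) \<notin> \<int>"
      using frac_eq_0_iff[of "1 / 2 :: real"] frac_eq[of "1 / 2 :: real"] by simp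
    ultimately show ?thesis by blast
  qed
  then obtain t where t: "t \<notin> \<int>"
    "\<And>m y r. (y, r) \<in> \<Gamma>\<^sub>0 \<Longrightarrow> y = of_int m * z \<Longrightarrow> r - of_int m * t \<in> \<int>"
    by blast
  obtain \<Gamma>\<^sub>1 where \<Gamma>\<^sub>1: "circle_graph \<Gamma>\<^sub>1" "\<Gamma>\<^sub>0 \<subseteq> \<Gamma>\<^sub>1" "(z, t) \<in> \<Gamma>\<^sub>1"
    by (rule circle_graph_extend[OF \<Gamma>\<^sub>0 t(2)])
  define \<A> where "\<A> = {\<Gamma>. circle_graph \<Gamma> \<and> (z, t) \<in> \<Gamma>}"
  have "\<exists>\<Gamma>\<in>\<A>. \<forall>X\<in>\<A>. \<Gamma> \<subseteq> X \<longrightarrow> X = \<Gamma>"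
  proof (rule subset_Zorn_nonempty)
    show "\<A> \<noteq> {}" using \<Gamma>\<^sub>1 by (auto simp: \<A>_def)
    fix \<C> assume C: "\<C> \<noteq> {}" "subset.chain \<A> \<C>"
    have 1: "p - q \<in> \<Union>\<C>" if pq: "p \<in> X" "X \<in> \<C>" "q \<in> Y" "Y \<in> \<C>" for p q X Y
    proof -
      have "X \<subseteq> Y \<or> Y \<subseteq> X" using C(2) pq by (auto simp: subset_chain_def)
      moreover have "circle_graph X" "circle_graph Y"
        using C(2) pq by (auto simp: subset_chain_def \<A>_def)
      ultimately show ?thesis using pq circle_graph_diff by (metis UnionI subsetD)
    qed
    have 2: "(0, r) \<in> X \<longleftrightarrow> r \<in> \<int>" "(z, t) \<in> X" if "X \<in> \<C>" for X r
      using C(2) that by (auto simp: subset_chain_def \<A>_def circle_graph_def)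
    obtain X where X: "X \<in> \<C>" using C(1) by blast
    have "circle_graph (\<Union>\<C>)"
      unfolding circle_graph_def
    proof (intro conjI ballI allI)
      show "p - q \<in> \<Union>\<C>" if "p \<in> \<Union>\<C>" "q \<in> \<Union>\<C>" for p q
        using that 1 by (elim UnionE)
      show "(0, r) \<in> \<Union>\<C> \<longleftrightarrow> r \<in> \<int>" for r
        using X 2(1) by (metis UnionI UnionE)
    qed
    moreover have "(z, t) \<in> \<Union>\<C>" using 2(2)[OF X] X by (rule UnionI[rotated])
    ultimately show "\<Union>\<C> \<in> \<A>" by (simp add: \<A>_def)
  qed
  then obtain \<Gamma> where \<Gamma>: "circle_graph \<Gamma>" "(z, t) \<in> \<Gamma>"
    and max: "\<And>\<Gamma>'. circle_graph \<Gamma>' \<Longrightarrow> \<Gamma> \<subseteq> \<Gamma>' \<Longrightarrow> \<Gamma>' = \<Gamma>"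
    unfolding \<A>_def by blast
  have "\<exists>t. (x, t) \<in> \<Gamma>" for x by (rule circle_graph_total[OF \<Gamma>(1) max])
  then obtain \<psi> where \<psi>: "\<And>x. (x, \<psi> x) \<in> \<Gamma>" by metis
  have *: "r \<in> \<int>" if "(0, r) \<in> \<Gamma>" for r using that \<Gamma> by (simp add: circle_graph_def)
  show thesis
  proof
    fix x y
    have "(x + y, \<psi> (x + y)) - ((x, \<psi> x) + (y, \<psi> y)) \<in> \<Gamma>"
      using circle_graph_diff circle_graph_add \<Gamma>(1) \<psi> by blast
    then show "\<psi> (x + y) - (\<psi> x + \<psi> y) \<in> \<int>" by (intro *) simp
  next
    have "(z, \<psi> z) - (z, t) \<in> \<Gamma>" using circle_graph_diff \<Gamma> \<psi> by blast
    then have "\<psi> z - t \<in> \<int>" by (intro *) simp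
    then show "\<psi> z \<notin> \<int>" using t(1) by (metis Ints_diff diff_diff_eq2 add_diff_cancel_left')
  qed
qed

text \<open>The colour of \<open>z\<close> records, for every \<open>i\<close>, roughly where the
  character of \<open>c i * z\<close> lies on the circle. Equal colours make each summand nearly
  trivial under the character, hence also the sum, whereas \<open>b\<close> has a character value
  bounded away from the integers.\<close>

lemma Straus_colouring:
  fixes c :: "'i \<Rightarrow> 'k::ring_1"
  assumes "finite I" "b \<noteq> 0"
  obtains \<kappa> :: "'k \<Rightarrow> ('i \<Rightarrow> int)" where "finite (range \<kappa>)"
    and "\<forall>x y. (\<forall>i\<in>I. \<kappa> (x i) = \<kappa> (y i)) \<longrightarrow> (\<Sum>i\<in>I. c i * (x i - y i)) \<noteq> b"
proof -
  obtain \<psi> :: "'k \<Rightarrow> real"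
    where \<psi>: "\<And>x y. \<psi> (x + y) - (\<psi> x + \<psi> y) \<in> \<int>" "\<psi> b \<notin> \<int>"
    using additive_character_exists[OF assms(2)] by blast
  \<comment> \<open>\<open>\<delta>\<close> bounds the distance of \<open>\<psi> b\<close> from the
    integers, and \<open>N\<close> is taken so large that \<open>card I\<close> errors of size
    \<open>1 / N\<close> stay below \<open>\<delta>\<close> in total.\<close>
  have "open (- \<int> :: real set)" by (simp add: open_Compl)
  then obtain \<delta> where \<delta>: "\<delta> > 0" "ball (\<psi> b) \<delta> \<subseteq> - \<int>"
    using \<psi>(2) by (meson ComplI openE)
  obtain N :: nat where N: "real (card I) / \<delta> < real N" using reals_Archimedean2 by blast
  have "0 \<le> real (card I) / \<delta>" using \<delta>(1) by simp
  with N have N0: "N > 0" by (cases N) auto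
  have N': "real (card I) * (1 / N) < \<delta>"
    using N \<delta>(1) N0 by (simp add: field_simps)
  \<comment> \<open>The circle is cut into \<open>N\<close> equal arcs; coordinate \<open>i\<close>
    of the colour is the index of the arc containing the value at \<open>c i * z\<close>.\<close>
  define \<kappa> where "\<kappa> z = (\<lambda>i\<in>I. \<lfloor>real N * frac (\<psi> (c i * z))\<rfloor>)" for z
  show thesis
  proof (rule that[of \<kappa>]; (intro allI impI)?)
    have "\<kappa> z \<in> I \<rightarrow>\<^sub>E {0..<int N}" for z
      using N0 by (auto simp: \<kappa>_def floor_less_iff frac_lt_1)
    then show "finite (range \<kappa>)"
      by (meson finite_PiE assms(1) finite_atLeastLessThan_int finite_subset image_subsetI)
  next
    fix x y assume eq: "\<forall>i\<in>I. \<kappa> (x i) = \<kappa> (y i)"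
    \<comment> \<open>\<open>e i\<close> is a small real representative of the circle value at
      \<open>c i * (x i - y i)\<close>: both fractional parts lie in the same arc. Only coordinate
      \<open>i\<close> of the colours of \<open>x i\<close> and \<open>y i\<close> is
      compared.\<close>
    define e where "e i = frac (\<psi> (c i * x i)) - frac (\<psi> (c i * y i))" for i
    have e: "\<bar>e i\<bar> \<le> 1 / N" if "i \<in> I" for i
    proof -
      have "\<lfloor>real N * frac (\<psi> (c i * x i))\<rfloor> = \<lfloor>real N * frac (\<psi> (c i * y i))\<rfloor>"
        using fun_cong[OF bspec[OF eq that], of i] that by (simp add: \<kappa>_def)
      then have "\<bar>real N * frac (\<psi> (c i * x i)) - real N * frac (\<psi> (c i * y i))\<bar> \<le> 1"
        by linarith
      then have "\<bar>real N * e i\<bar> \<le> 1" by (simp add: e_def algebra_simps)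
      then show ?thesis using N0 by (simp add: abs_mult field_simps)
    qed
    have 0: "\<psi> 0 \<in> \<int>" using \<psi>(1)[of 0 0] by (simp add: minus_in_Ints_iff)
    have step: "\<psi> (c i * (x i - y i)) - e i \<in> \<int>" for i
    proof -
      have "\<psi> (c i * x i) - (\<psi> (c i * (x i - y i)) + \<psi> (c i * y i)) \<in> \<int>" (is "?z \<in> _")
        using \<psi>(1)[of "c i * (x i - y i)" "c i * y i"] by (simp add: algebra_simps)
      moreover have "\<psi> (c i * (x i - y i)) - e i
          = of_int (\<lfloor>\<psi> (c i * x i)\<rfloor> - \<lfloor>\<psi> (c i * y i)\<rfloor>) - ?z"
        by (simp add: e_def frac_def)
      ultimately show ?thesis by (metis Ints_diff Ints_of_int)
    qed
    have "\<psi> (\<Sum>i\<in>J. c i * (x i - y i)) - (\<Sum>i\<in>J. e i) \<in> \<int>" if "finite J" for J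
      using that
    proof (induction J)
      case empty
      then show ?case using 0 by simp
    next
      case (insert j J)
      let ?s = "\<Sum>i\<in>J. c i * (x i - y i)" and ?d = "c j * (x j - y j)"
      have "\<psi> (?d + ?s) - (e j + (\<Sum>i\<in>J. e i)) =
          (\<psi> (?d + ?s) - (\<psi> ?d + \<psi> ?s)) + (\<psi> ?d - e j) + (\<psi> ?s - (\<Sum>i\<in>J. e i))"
        by simp
      also have "\<dots> \<in> \<int>" using \<psi>(1) step insert.IH by (intro Ints_add)
      finally show ?case using insert.hyps by simp
    qed
    then have int: "\<psi> (\<Sum>i\<in>I. c i * (x i - y i)) - (\<Sum>i\<in>I. e i) \<in> \<int>" using assms(1) by blast
    show "(\<Sum>i\<in>I. c i * (x i - y i)) \<noteq> b"
    proof
      assume "(\<Sum>i\<in>I. c i * (x i - y i)) = b"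
      with int have "\<psi> b - (\<Sum>i\<in>I. e i) \<in> \<int>" by simp
      moreover have "\<bar>\<Sum>i\<in>I. e i\<bar> \<le> real (card I) * (1 / N)"
        using e by (intro order_trans[OF sum_abs] sum_bounded_above) auto
      then have "\<psi> b - (\<Sum>i\<in>I. e i) \<in> ball (\<psi> b) \<delta>"
        using N' by (simp add: dist_real_def)
      ultimately show False using \<delta>(2) by blast
    qed
  qed
qed

section \<open>Closed subspaces of function spaces\<close>

text \<open>A basis of \<open>D\<close> stays independent when \<open>a\<close> is added, so the
  values \<open>0\<close> on the basis and \<open>1\<close> at \<open>a\<close> may be prescribed
  and extended linearly.\<close>

lemma (in vector_space) separating_functional:
  assumes "subspace D" "a \<notin> D"
  obtains \<phi> where "Vector_Spaces.linear scale (*) \<phi>" "\<And>x. x \<in> D \<Longrightarrow> \<phi> x = 0" "\<phi> a = 1"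
proof -
  interpret pair: vector_space_pair scale "(*)" by unfold_locales
  obtain B where B: "B \<subseteq> D" "independent B" "D \<subseteq> span B"
    using maximal_independent_subset by blast
  then have "a \<notin> span B" using span_minimal[OF B(1) assms(1)] assms(2) by blast
  then have "independent (insert a B)" using B(2) by (rule independent_insertI)
  from pair.linear_independent_extend[OF this, of "\<lambda>x. if x = a then 1 else 0"]
  obtain \<phi> where \<phi>: "Vector_Spaces.linear scale (*) \<phi>"
    "\<forall>x\<in>insert a B. \<phi> x = (if x = a then 1 else 0)" by blast
  show thesis
  proof
    show "\<phi> x = 0" if "x \<in> D" for x
    proof (rule pair.linear_eq_0_on_span[OF \<phi>(1)])
      show "x \<in> span B" using that B(3) by blast
      show "\<phi> y = 0" if "y \<in> B" for y using \<phi>(2) that B(1) assms(2) by auto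
    qed
  qed (use \<phi> in auto)
qed

text \<open>Coefficient vectors of finitely supported functionals live in this space of total
  functions, with value \<open>0\<close> off the support. The elements of
  \<open>W \<rightarrow>\<^sub>E UNIV\<close> are the vectors that they are paired with.\<close>

interpretation fun_space: vector_space "\<lambda>(c::'k::field) (f::'w \<Rightarrow> 'k) w. c * f w"
  by unfold_locales (auto simp: fun_eq_iff algebra_simps)

lemma linear_finite_support:
  fixes \<phi> :: "('w \<Rightarrow> 'k::field) \<Rightarrow> 'k"
  assumes \<phi>: "Vector_Spaces.linear (\<lambda>c f w. c * f w) (*) \<phi>" and "finite T"
  shows "\<phi> (\<lambda>w. if w \<in> T then f w else 0) = (\<Sum>t\<in>T. f t * \<phi> (\<lambda>w. if w = t then 1 else 0))"
  using assms(2)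
proof (induction T)
  case empty
  interpret Vector_Spaces.linear "\<lambda>(c::'k) (f::'w \<Rightarrow> 'k) w. c * f w" "(*)" \<phi> by fact
  show ?case using zero by (simp add: zero_fun_def)
next
  case (insert t T)
  interpret Vector_Spaces.linear "\<lambda>(c::'k) (f::'w \<Rightarrow> 'k) w. c * f w" "(*)" \<phi> by fact
  let ?e = "\<lambda>w. if w = t then 1 else 0"
  have "(\<lambda>w. if w \<in> insert t T then f w else 0) = (\<lambda>w. f t * ?e w) + (\<lambda>w. if w \<in> T then f w else 0)"
    using insert.hyps(2) by (auto simp: fun_eq_iff)
  then have "\<phi> (\<lambda>w. if w \<in> insert t T then f w else 0) =
      f t * \<phi> ?e + \<phi> (\<lambda>w. if w \<in> T then f w else 0)"
    by (simp only: add scale)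
  then show ?case using insert by simp
qed

text \<open>A basic neighbourhood of \<open>v\<close> that misses \<open>V\<close> constrains only a
  finite set \<open>T\<close> of coordinates. So the restriction of \<open>v\<close> to
  \<open>T\<close> is not the restriction of an element of \<open>V\<close>, and linear algebra on
  \<open>T\<close> separates them. Thus closed subspaces are cut out by finitely supported
  functionals.\<close>

lemma closed_subspace_separation:
  fixes V :: "('w \<Rightarrow> 'k::field) set"
  assumes V: "fun_subspace W V" "closedin (pointwise_topology W) V"
    and v: "v \<in> W \<rightarrow>\<^sub>E UNIV" "v \<notin> V"
  obtains T a where "finite T" "T \<subseteq> W"
    "\<And>u. u \<in> V \<Longrightarrow> (\<Sum>t\<in>T. a t * u t) = 0" "(\<Sum>t\<in>T. a t * v t) = 1"
proof -
  have "openin (pointwise_topology W) ((W \<rightarrow>\<^sub>E UNIV) - V)"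
    using V(2) by (simp add: closedin_def pointwise_topology_def)
  then have "\<forall>x\<in>(W \<rightarrow>\<^sub>E UNIV) - V. \<exists>N. finite {w \<in> W. N w \<noteq> UNIV} \<and>
      x \<in> Pi\<^sub>E W N \<and> Pi\<^sub>E W N \<subseteq> (W \<rightarrow>\<^sub>E UNIV) - V"
    unfolding pointwise_topology_def openin_product_topology_alt by simp
  from bspec[OF this DiffI[OF v]] obtain N where N: "finite {w \<in> W. N w \<noteq> UNIV}"
    "v \<in> Pi\<^sub>E W N" "Pi\<^sub>E W N \<subseteq> (W \<rightarrow>\<^sub>E UNIV) - V"
    by blast
  define T where "T = {w \<in> W. N w \<noteq> UNIV}"
  \<comment> \<open>Restriction to \<open>T\<close>, extended by \<open>0\<close> rather than
    \<open>undefined\<close> so that the images form a subspace of \<open>fun_space\<close>.\<close>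
  define res where "res u = (\<lambda>w. if w \<in> T then u w else 0)" for u :: "'w \<Rightarrow> 'k"
  have T: "finite T" "T \<subseteq> W" using N(1) by (auto simp: T_def)
  have agree: "u \<notin> V" if u: "u \<in> W \<rightarrow>\<^sub>E UNIV" "\<And>t. t \<in> T \<Longrightarrow> u t = v t" for u
  proof -
    have "u w \<in> N w" if "w \<in> W" for w
      using u(2)[of w] N(2) that by (cases "w \<in> T") (auto simp: T_def)
    then have "u \<in> Pi\<^sub>E W N" using u(1) by (auto simp: PiE_iff)
    then show ?thesis using N(3) by blast
  qed
  have sub: "fun_space.subspace (res ` V)"
  proof (rule fun_space.subspaceI)
    have "(\<lambda>w\<in>W. 0) \<in> V" using V(1) by (simp add: fun_subspace_def)
    moreover have "0 = res (\<lambda>w\<in>W. 0)" using T(2) by (auto simp: res_def fun_eq_iff)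
    ultimately show "0 \<in> res ` V" by blast
  next
    fix x y assume "x \<in> res ` V" "y \<in> res ` V"
    then obtain f g where fg: "f \<in> V" "x = res f" "g \<in> V" "y = res g" by blast
    then have "(\<lambda>w\<in>W. f w + g w) \<in> V" using V(1) by (simp add: fun_subspace_def)
    moreover have "x + y = res (\<lambda>w\<in>W. f w + g w)"
      using T(2) by (auto simp: fg res_def fun_eq_iff)
    ultimately show "x + y \<in> res ` V" by blast
  next
    fix c x assume "x \<in> res ` V"
    then obtain f where f: "f \<in> V" "x = res f" by blast
    then have "(\<lambda>w\<in>W. c * f w) \<in> V" using V(1) by (simp add: fun_subspace_def)
    moreover have "(\<lambda>w. c * x w) = res (\<lambda>w\<in>W. c * f w)"
      using T(2) by (auto simp: f res_def fun_eq_iff)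
    ultimately show "(\<lambda>w. c * x w) \<in> res ` V" by blast
  qed
  have "res v \<notin> res ` V"
  proof
    assume "res v \<in> res ` V"
    then obtain u where u: "u \<in> V" "res v = res u" by blast
    have "u t = v t" if "t \<in> T" for t
      using fun_cong[OF u(2), of t] that by (simp add: res_def)
    moreover have "u \<in> W \<rightarrow>\<^sub>E UNIV" using u(1) V(1) by (auto simp: fun_subspace_def)
    ultimately show False using agree u(1) by blast
  qed
  with sub obtain \<phi> where \<phi>: "Vector_Spaces.linear (\<lambda>(c::'k) (f::'w \<Rightarrow> 'k) w. c * f w) (*) \<phi>"
    "\<And>x. x \<in> res ` V \<Longrightarrow> \<phi> x = 0" "\<phi> (res v) = 1"
    using fun_space.separating_functional[of "res ` V" "res v"] by blast
  have eq: "\<phi> (res u) = (\<Sum>t\<in>T. \<phi> (\<lambda>w. if w = t then 1 else 0) * u t)" for u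
    unfolding res_def linear_finite_support[OF \<phi>(1) T(1)] by (simp add: mult.commute)
  show thesis
  proof (rule that[OF T])
    show "(\<Sum>t\<in>T. \<phi> (\<lambda>w. if w = t then 1 else 0) * u t) = 0" if "u \<in> V" for u
      using \<phi>(2)[of "res u"] that by (simp only: eq[symmetric] imageI)
    show "(\<Sum>t\<in>T. \<phi> (\<lambda>w. if w = t then 1 else 0) * v t) = 1"
      using \<phi>(3) by (simp only: eq)
  qed
qed

text \<open>A function \<open>h\<close> on \<open>W\<close> amounts to a linear functional on
  finitely supported coefficient vectors. Lying in \<open>V\<close> means killing the annihilator of
  \<open>V\<close>, since \<open>V\<close> is closed; the identifications mean killing the
  differences of pairs in \<open>P\<close>. The hypothesis \<open>no_relation\<close> says that
  \<open>a\<close> is not in the span of these vectors, so a functional with value \<open>1\<close>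
  at \<open>a\<close> exists.\<close>

lemma function_with_identifications:
  fixes V :: "('w \<Rightarrow> 'k::field) set"
  assumes V: "fun_subspace W V" "closedin (pointwise_topology W) V"
    and S: "finite S" "S \<subseteq> W" and P: "P \<subseteq> W \<times> W"
    and no_relation: "\<And>I c. finite I \<Longrightarrow> I \<subseteq> P \<Longrightarrow>
      \<exists>v\<in>V. (\<Sum>s\<in>S. a s * v s) \<noteq> (\<Sum>p\<in>I. c p * (v (fst p) - v (snd p)))"
  obtains h where "h \<in> V" "(\<Sum>s\<in>S. a s * h s) = 1" "\<forall>(x, y)\<in>P. h x = h y"
proof -
  \<comment> \<open>On \<open>V\<close>, the functional with coefficients \<open>b\<close> supported
    in \<open>T\<close> equals the combination, with coefficients \<open>c\<close> supported in
    \<open>I\<close>, of differences of pairs.\<close>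
  define rel where "rel T I b c \<longleftrightarrow> finite T \<and> T \<subseteq> W \<and> finite I \<and> I \<subseteq> P \<and>
    (\<forall>w. w \<notin> T \<longrightarrow> b w = 0) \<and> (\<forall>p. p \<notin> I \<longrightarrow> c p = 0) \<and>
    (\<forall>v\<in>V. (\<Sum>w\<in>T. b w * v w) = (\<Sum>p\<in>I. c p * (v (fst p) - v (snd p))))" for T I b c
  \<comment> \<open>The annihilator of \<open>V\<close> plus the span of the differences of pairs in \<open>P\<close>. A functional
    vanishing on \<open>D\<close> but not at \<open>a\<close> is evaluation at the desired \<open>h\<close>.\<close>
  define D where "D = {b. \<exists>T I c. rel T I b c}"
  \<comment> \<open>Coefficients vanish off their supports, so the supports can be enlarged. This
    puts two relations over common supports before they are added.\<close>
  have mono: "rel T' I' b c"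
    if "rel T I b c" "T \<subseteq> T'" "I \<subseteq> I'" "finite T'" "T' \<subseteq> W" "finite I'" "I' \<subseteq> P" for T T' I I' b c
  proof -
    have "(\<Sum>w\<in>T. b w * v w) = (\<Sum>w\<in>T'. b w * v w)" for v
      by (rule sum.mono_neutral_left) (use that in \<open>auto simp: rel_def\<close>)
    moreover have "(\<Sum>p\<in>I. c p * (v (fst p) - v (snd p))) =
        (\<Sum>p\<in>I'. c p * (v (fst p) - v (snd p)))" for v
      by (rule sum.mono_neutral_left) (use that in \<open>auto simp: rel_def\<close>)
    ultimately show ?thesis using that unfolding rel_def by (auto simp del: split_paired_All)
  qed
  have sub: "fun_space.subspace D"
  proof (rule fun_space.subspaceI)
    have "rel {} {} 0 (\<lambda>_. 0)" by (simp add: rel_def)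
    then show "0 \<in> D" unfolding D_def by blast
  next
    fix b b' assume "b \<in> D" "b' \<in> D"
    then obtain T I c T' I' c' where r: "rel T I b c" "rel T' I' b' c'"
      unfolding D_def by blast
    have "rel (T \<union> T') (I \<union> I') b c"
      by (rule mono[OF r(1)]) (use r in \<open>simp_all add: rel_def\<close>)
    moreover have "rel (T \<union> T') (I \<union> I') b' c'"
      by (rule mono[OF r(2)]) (use r in \<open>simp_all add: rel_def\<close>)
    ultimately have "rel (T \<union> T') (I \<union> I') (b + b') (c + c')"
      unfolding rel_def by (simp add: distrib_right sum.distrib)
    then show "b + b' \<in> D" unfolding D_def by blast
  next
    fix d b assume "b \<in> D"
    then obtain T I c where r: "rel T I b c"
      unfolding D_def by blast
    then have "rel T I (\<lambda>w. d * b w) (\<lambda>p. d * c p)"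
      unfolding rel_def by (simp add: mult.assoc sum_distrib_left[symmetric])
    then show "(\<lambda>w. d * b w) \<in> D" unfolding D_def by blast
  qed
  define a' where "a' = (\<lambda>w. if w \<in> S then a w else 0)"
  have "a' \<notin> D"
  proof
    assume "a' \<in> D"
    then obtain T I c where r: "rel T I a' c" unfolding D_def by blast
    have "rel (S \<union> T) I a' c"
      by (rule mono[OF r]) (use r S in \<open>auto simp: rel_def\<close>)
    then have r': "finite I" "I \<subseteq> P" "finite (S \<union> T)"
      "\<And>v. v \<in> V \<Longrightarrow> (\<Sum>w\<in>S \<union> T. a' w * v w) = (\<Sum>p\<in>I. c p * (v (fst p) - v (snd p)))"
      by (auto simp: rel_def)
    have "(\<Sum>w\<in>S. a w * v w) = (\<Sum>w\<in>S \<union> T. a' w * v w)" for v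
      by (rule sum.mono_neutral_cong_left) (use r'(3) in \<open>auto simp: a'_def\<close>)
    with r' no_relation[of I c] show False by metis
  qed
  with sub obtain \<phi> where \<phi>: "Vector_Spaces.linear (\<lambda>(c::'k) (f::'w \<Rightarrow> 'k) w. c * f w) (*) \<phi>"
    "\<And>x. x \<in> D \<Longrightarrow> \<phi> x = 0" "\<phi> a' = 1"
    using fun_space.separating_functional[of D a'] by blast
  define h where "h = (\<lambda>w\<in>W. \<phi> (\<lambda>x. if x = w then 1 else 0))"
  have \<phi>_eq: "\<phi> (\<lambda>w. if w \<in> T then b w else 0) = (\<Sum>t\<in>T. b t * h t)"
    if "finite T" "T \<subseteq> W" for T b
    unfolding linear_finite_support[OF \<phi>(1) that(1)]
    by (rule sum.cong) (use that(2) in \<open>auto simp: h_def\<close>)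
  show thesis
  proof
    show "(\<Sum>s\<in>S. a s * h s) = 1" using \<phi>_eq[OF S] \<phi>(3) by (simp add: a'_def)
    show "h \<in> V"
    proof (rule ccontr)
      assume "h \<notin> V"
      moreover have "h \<in> W \<rightarrow>\<^sub>E UNIV" by (simp add: h_def)
      ultimately obtain T b where T: "finite T" "T \<subseteq> W"
        "\<And>u. u \<in> V \<Longrightarrow> (\<Sum>t\<in>T. b t * u t) = 0" "(\<Sum>t\<in>T. b t * h t) = 1"
        using closed_subspace_separation[OF V] by blast
      \<comment> \<open>\<open>rel\<close> demands vanishing off \<open>T\<close>, hence the
        truncation of \<open>b\<close>. The empty set of pairs expresses that \<open>b\<close>
        annihilates \<open>V\<close>.\<close>
      have "(\<Sum>w\<in>T. (if w \<in> T then b w else 0) * v w) = (\<Sum>w\<in>T. b w * v w)" for v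
        by (rule sum.cong) auto
      then have "rel T {} (\<lambda>w. if w \<in> T then b w else 0) (\<lambda>_. 0)"
        using T by (simp add: rel_def)
      then have "\<phi> (\<lambda>w. if w \<in> T then b w else 0) = 0" using \<phi>(2) unfolding D_def by blast
      with \<phi>_eq[OF T(1,2)] T(4) show False by simp
    qed
    show "\<forall>(x, y)\<in>P. h x = h y"
    proof clarify
      fix x y assume xy: "(x, y) \<in> P"
      then have W: "x \<in> W" "y \<in> W" using P by auto
      show "h x = h y"
      \<comment> \<open>The diagonal is split off because for \<open>x = y\<close> the vector
        \<open>?b\<close> below would be an indicator instead of \<open>0\<close>.\<close>
      proof (cases "x = y")
        case False
        let ?b = "\<lambda>w. if w \<in> {x, y} then (if w = x then 1 else - 1) else (0 :: 'k)"
        have "rel {x, y} {(x, y)} ?b (\<lambda>p. if p = (x, y) then 1 else 0)"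
          using False W xy by (simp add: rel_def)
        then have "\<phi> ?b = 0" using \<phi>(2) unfolding D_def by blast
        with \<phi>_eq[of "{x, y}" "\<lambda>w. if w = x then 1 else - 1"] W False
        show ?thesis by simp
      qed simp
    qed
  qed
qed

section \<open>The Ramsey property of automorphism groups\<close>

lemma Aut_iff: "g \<in> Aut L M \<longleftrightarrow> embedding L M M g \<and> g permutes univ M"
  using permutes_image[of g "univ M"] unfolding Aut_def isomorphism_def by blast

lemma map_tuples: "h ` A \<subseteq> B \<Longrightarrow> xs \<in> tuples n A \<Longrightarrow> map h xs \<in> tuples n B"
  by (auto simp: tuples_def)

lemma embedding_comp:
  assumes "embedding L A B h" "embedding L B C k"
  shows "embedding L A C (k \<circ> h)"
proof -
  have h: "h ` univ A \<subseteq> univ B" and k: "k ` univ B \<subseteq> univ C"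
    using assms by (auto simp: embedding_def)
  have "inj_on (k \<circ> h) (univ A)"
    using assms by (auto simp: embedding_def intro: comp_inj_on inj_on_subset)
  moreover have "(k \<circ> h) (fint A f xs) = fint C f (map (k \<circ> h) xs)"
    if "f \<in> fsyms L" "xs \<in> tuples (farity L f) (univ A)" for f xs
    using assms that map_tuples[OF h that(2)] by (simp add: embedding_def)
  moreover have "rint A r xs \<longleftrightarrow> rint C r (map (k \<circ> h) xs)"
    if "r \<in> rsyms L" "xs \<in> tuples (rarity L r) (univ A)" for r xs
    using assms that map_tuples[OF h that(2)] by (simp add: embedding_def)
  moreover have "(k \<circ> h) ` univ A \<subseteq> univ C" using h k by auto
  ultimately show ?thesis unfolding embedding_def by blast
qed

lemma embedding_cong:
  assumes "embedding L A B h" "\<And>x. x \<in> univ A \<Longrightarrow> h' x = h x" "fclosed L A (univ A)"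
  shows "embedding L A B h'"
proof -
  have m: "map h' xs = map h xs" if "xs \<in> tuples n (univ A)" for n xs
    using that assms(2) by (auto simp: tuples_def)
  have "h' (fint A f xs) = fint B f (map h' xs)"
    if "f \<in> fsyms L" "xs \<in> tuples (farity L f) (univ A)" for f xs
  proof -
    have "fint A f xs \<in> univ A" using assms(3) that by (auto simp: fclosed_def)
    then show ?thesis using assms(1,2) that by (simp add: embedding_def m)
  qed
  moreover have "rint A r xs \<longleftrightarrow> rint B r (map h' xs)"
    if "r \<in> rsyms L" "xs \<in> tuples (rarity L r) (univ A)" for r xs
    using assms(1) that by (simp add: embedding_def m)
  moreover have "h' ` univ A \<subseteq> univ B" "inj_on h' (univ A)"
    using assms(1,2) by (auto simp: embedding_def inj_on_def)
  ultimately show ?thesis unfolding embedding_def by blast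
qed

lemma isomorphism_inv_into:
  assumes "isomorphism L A B h" "fclosed L A (univ A)"
  shows "isomorphism L B A (inv_into (univ A) h)"
proof -
  let ?k = "inv_into (univ A) h"
  have h: "embedding L A B h" "h ` univ A = univ B" "inj_on h (univ A)"
    using assms(1) by (auto simp: isomorphism_def embedding_def)
  have img: "?k ` univ B = univ A"
    using h by (metis inv_into_image_cancel subset_refl)
  have m: "map ?k ys \<in> tuples n (univ A)" "map h (map ?k ys) = ys" if "ys \<in> tuples n (univ B)" for n ys
  proof -
    show "map ?k ys \<in> tuples n (univ A)" by (rule map_tuples[OF _ that]) (simp add: img)
    have "h (?k y) = y" if "y \<in> univ B" for y using that h(2) by (intro f_inv_into_f) simp
    then show "map h (map ?k ys) = ys"
      using that by (auto simp: tuples_def intro!: map_idI)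
  qed
  have "?k (fint B f ys) = fint A f (map ?k ys)"
    if "f \<in> fsyms L" "ys \<in> tuples (farity L f) (univ B)" for f ys
  proof -
    have "fint A f (map ?k ys) \<in> univ A"
      using assms(2) m(1)[OF that(2)] that(1) by (auto simp: fclosed_def)
    moreover have "h (fint A f (map ?k ys)) = fint B f ys"
      using h(1) m[OF that(2)] that(1) unfolding embedding_def by metis
    ultimately show ?thesis using h(3) by (metis inv_into_f_f)
  qed
  moreover have "rint B r ys \<longleftrightarrow> rint A r (map ?k ys)"
    if "r \<in> rsyms L" "ys \<in> tuples (rarity L r) (univ B)" for r ys
    using h(1) m[OF that(2)] that(1) unfolding embedding_def by metis
  moreover have "inj_on ?k (univ B)" using h(2) by (simp add: inj_on_inv_into)
  ultimately show ?thesis using img by (simp add: isomorphism_def embedding_def)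
qed

lemma isomorphism_comp:
  "isomorphism L A B h \<Longrightarrow> isomorphism L B C k \<Longrightarrow> isomorphism L A C (k \<circ> h)"
  unfolding isomorphism_def using embedding_comp[of L A B h C k] by (metis image_comp)

lemma isomorphic_sym: "isomorphic L A B \<Longrightarrow> fclosed L A (univ A) \<Longrightarrow> isomorphic L B A"
  using isomorphism_inv_into unfolding isomorphic_def by blast

lemma isomorphic_trans: "isomorphic L A B \<Longrightarrow> isomorphic L B C \<Longrightarrow> isomorphic L A C"
  using isomorphism_comp unfolding isomorphic_def by blast

lemma embedding_id: "embedding L A A id"
  by (simp add: embedding_def)

lemma Aut_id: "id \<in> Aut L M"
  by (simp add: Aut_iff embedding_id permutes_id)

lemma Aut_comp: "g \<in> Aut L M \<Longrightarrow> h \<in> Aut L M \<Longrightarrow> g \<circ> h \<in> Aut L M"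
  by (auto simp: Aut_iff intro: embedding_comp permutes_compose)

lemma Aut_inv:
  assumes "is_structure L M" "g \<in> Aut L M"
  shows "inv g \<in> Aut L M"
proof -
  have g: "isomorphism L M M g" "g permutes univ M" using assms(2) by (auto simp: Aut_def)
  have "inv g x = inv_into (univ M) g x" if "x \<in> univ M" for x
    using g(2) that by (metis permutes_image permutes_inv_eq f_inv_into_f)
  then have "embedding L M M (inv g)"
    using embedding_cong isomorphism_inv_into[OF g(1)] assms(1)
    unfolding isomorphism_def is_structure_def by blast
  then show ?thesis using permutes_inv[OF g(2)] by (simp add: Aut_iff)
qed

section \<open>Finite substructures, rigidity and homogeneity\<close>

lemma induced_simps [simp]:
  "univ (induced M X) = X" "fint (induced M X) = fint M" "rint (induced M X) = rint M"
  "induced (induced M Y) X = induced M X"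
  by (simp_all add: induced_def)

lemma fclosed_induced [simp]: "fclosed L (induced M X) Y \<longleftrightarrow> fclosed L M Y"
  by (simp add: fclosed_def)

lemma subuniverse_image:
  assumes "embedding L A B h" "subuniverse L A X"
  shows "subuniverse L B (h ` X)"
proof -
  have X: "X \<subseteq> univ A" "fclosed L A X" using assms(2) by (auto simp: subuniverse_def)
  have "fint B f ys \<in> h ` X" if s: "f \<in> fsyms L" "ys \<in> tuples (farity L f) (h ` X)" for f ys
  proof -
    have "ys \<in> lists (h ` X)" using s(2) by (auto simp: tuples_def)
    then obtain xs where xs: "ys = map h xs" "xs \<in> lists X" unfolding lists_image by blast
    then have "xs \<in> tuples (farity L f) X" using s(2) by (auto simp: tuples_def)
    moreover from this have "xs \<in> tuples (farity L f) (univ A)" using X(1) by (auto simp: tuples_def)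
    ultimately have "fint A f xs \<in> X" "h (fint A f xs) = fint B f ys"
      using X(2) assms(1) s(1) xs(1) by (auto simp: fclosed_def embedding_def)
    then show ?thesis by (metis imageI)
  qed
  moreover have "h ` X \<subseteq> univ B" using X(1) assms(1) unfolding embedding_def by blast
  ultimately show ?thesis by (simp add: subuniverse_def fclosed_def)
qed

lemma embedding_induced:
  assumes "embedding L A B h" "X \<subseteq> univ A"
  shows "isomorphism L (induced A X) (induced B (h ` X)) h"
proof -
  have "xs \<in> tuples n (univ A)" if "xs \<in> tuples n X" for n xs
    using that assms(2) by (auto simp: tuples_def)
  then show ?thesis
    using assms inj_on_subset by (auto simp: isomorphism_def embedding_def)
qed

lemma embedding_inclusion: "X \<subseteq> univ M \<Longrightarrow> embedding L (induced M X) M id"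
  unfolding embedding_def by (simp add: tuples_def)

lemma subuniverse_hull:
  assumes "is_structure L M" "X \<subseteq> univ M"
  shows "subuniverse L M (subuniverse L M hull X)"
proof -
  let ?\<T> = "{Y. subuniverse L M Y \<and> X \<subseteq> Y}"
  have ne: "univ M \<in> ?\<T>" using assms by (simp add: is_structure_def subuniverse_def)
  have "fint M f xs \<in> \<Inter>?\<T>" if "f \<in> fsyms L" "xs \<in> tuples (farity L f) (\<Inter>?\<T>)" for f xs
  proof
    fix Y assume Y: "Y \<in> ?\<T>"
    then have "xs \<in> tuples (farity L f) Y" using that(2) by (auto simp: tuples_def)
    then show "fint M f xs \<in> Y" using Y that(1) by (auto simp: subuniverse_def fclosed_def)
  qed
  then have "fclosed L M (\<Inter>?\<T>)" by (simp add: fclosed_def)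
  moreover have "\<Inter>?\<T> \<subseteq> univ M" using ne by blast
  ultimately show ?thesis by (simp add: hull_def subuniverse_def)
qed

text \<open>The members of \<open>age L M\<close> live on natural numbers, while subuniverses of
  \<open>M\<close> live in \<open>M\<close>. Transporting the structure along an injection links the
  two.\<close>

lemma nat_copy:
  fixes M :: "('f, 'r, 'a) struct"
  assumes "subuniverse L M X" "finite X"
  obtains N :: "('f, 'r, nat) struct" and h
  where "isomorphism L (induced M X) N h" "isomorphism L N (induced M X) (inv_into X h)"
    "N \<in> age L M"
proof -
  obtain h :: "'a \<Rightarrow> nat" where h: "inj_on h X" using finite_imp_inj_to_nat_seg[OF assms(2)] by blast
  define N where "N = \<lparr>univ = h ` X, fint = \<lambda>f xs. h (fint M f (map (inv_into X h) xs)),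
    rint = \<lambda>r xs. rint M r (map (inv_into X h) xs)\<rparr>"
  have "map (inv_into X h) (map h xs) = xs" if "xs \<in> tuples n X" for n xs
    using that h by (auto simp: tuples_def o_def intro!: map_idI)
  then have iso: "isomorphism L (induced M X) N h"
    using h by (simp add: isomorphism_def embedding_def N_def del: map_map)
  have cl: "fclosed L (induced M X) (univ (induced M X))"
    using assms(1) by (simp add: subuniverse_def)
  note inv = isomorphism_inv_into[OF iso cl, unfolded induced_simps]
  have "subuniverse L (induced M X) X" using assms(1) by (simp add: subuniverse_def)
  with iso have "subuniverse L N (h ` X)" using subuniverse_image unfolding isomorphism_def by blast
  then have "is_structure L N" by (simp add: is_structure_def subuniverse_def N_def)
  moreover have "embedding L N M (id \<circ> inv_into X h)"
    using inv embedding_inclusion[of X M L] assms(1) embedding_comp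
    unfolding isomorphism_def subuniverse_def by blast
  moreover have "finite (univ N)" using assms(2) by (simp add: N_def)
  ultimately have "N \<in> age L M" unfolding age_def by blast
  with iso inv that show thesis by blast
qed

text \<open>The restriction of \<open>g\<close> to \<open>X\<close> becomes an automorphism of a
  copy of \<open>X\<close> in the age, which rigidity makes trivial. Consequently an automorphism of
  \<open>M\<close> is determined on \<open>X\<close> by the set onto which it maps
  \<open>X\<close>.\<close>

lemma rigid_setwise_pointwise:
  fixes M :: "('f, 'r, 'a) struct"
  assumes rigid: "\<forall>N\<in>age L M. rigid L N"
    and X: "subuniverse L M X" "finite X" and g: "embedding L M M g" "g ` X = X" "x \<in> X"
  shows "g x = x"
proof -
  obtain N :: "('f, 'r, nat) struct" and h
    where h: "isomorphism L (induced M X) N h" "isomorphism L N (induced M X) (inv_into X h)"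
      and N: "N \<in> age L M"
    using nat_copy[OF X] by blast
  have univ_N: "univ N = h ` X" and inj: "inj_on h X"
    using h(1) by (auto simp: isomorphism_def embedding_def)
  have "X \<subseteq> univ M" using X(1) by (simp add: subuniverse_def)
  from embedding_induced[OF g(1) this] have "isomorphism L (induced M X) (induced M X) g"
    by (simp add: g(2))
  then have iso: "isomorphism L N N (h \<circ> (g \<circ> inv_into X h))" (is "isomorphism L N N ?y")
    by (rule isomorphism_comp[OF isomorphism_comp[OF h(2)] h(1)])
  \<comment> \<open>Members of \<open>Aut\<close> are the identity off the universe, so the
    conjugate of \<open>g\<close> is extended in this way.\<close>
  define y where "y n = (if n \<in> univ N then ?y n else n)" for n
  have "fclosed L N (univ N)" using N by (simp add: age_def is_structure_def)
  have iso': "embedding L N N ?y" "?y ` univ N = univ N" "inj_on ?y (univ N)"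
    using iso unfolding isomorphism_def embedding_def by blast+
  have y_eq: "y n = ?y n" if "n \<in> univ N" for n using that by (simp only: y_def if_True)
  have y: "embedding L N N y"
    by (rule embedding_cong[OF iso'(1) y_eq \<open>fclosed L N (univ N)\<close>])
  have "bij_betw ?y (univ N) (univ N)" using iso'(2,3) by (simp only: bij_betw_def simp_thms)
  then have "bij_betw y (univ N) (univ N)" using bij_betw_cong y_eq by blast
  then have "y permutes univ N" by (rule bij_imp_permutes) (simp add: y_def)
  with y have "y \<in> Aut L N" by (simp add: Aut_iff)
  with rigid N have "y = id" by (auto simp: rigid_def)
  then have "?y (h x) = h x" using g(3) univ_N by (metis y_def id_apply imageI)
  then have "h (g x) = h x" using inj g(3) by simp
  then show ?thesis using inj g(2,3) by (metis imageI inj_onD)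
qed

lemma homogeneous_image:
  assumes "Fraisse_structure L M" "subuniverse L M X" "finite X" "subuniverse L M Y" "finite Y"
    and "isomorphic L (induced M X) (induced M Y)"
  obtains g where "g \<in> Aut L M" "g ` X = Y"
proof -
  obtain h where h: "isomorphism L (induced M X) (induced M Y) h"
    using assms(6) by (auto simp: isomorphic_def)
  then obtain g where g: "g \<in> Aut L M" "\<forall>x\<in>X. g x = h x"
    using assms unfolding Fraisse_structure_def by blast
  have "g ` X = h ` X" using g(2) by (simp cong: image_cong)
  also have "\<dots> = Y" using h by (simp add: isomorphism_def)
  finally show thesis using that g(1) by blast
qed

text \<open>By rigidity and homogeneity, \<open>f\<close> is a finite colouring of the copies of the
  subuniverse \<open>A\<close> generated by \<open>A\<^sub>0\<close>. The Ramsey property is applied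
  to \<open>A\<close> inside a finite \<open>B\<close> containing all sets \<open>e\<close>
  A\<open>; a monochromatic copy of\<close>B\<open>is a translate by some\<close>g\<open>, and the sets\<close>(g
  \<circ> e) \<open>A\<close> lie in it.\<close>

lemma Ramsey_Aut:
  fixes M :: "('f, 'r, 'a) struct" and f :: "('a \<Rightarrow> 'a) \<Rightarrow> 'c"
  assumes R: "Ramsey_structure L M"
    and A\<^sub>0: "finite A\<^sub>0" "A\<^sub>0 \<subseteq> univ M" and E: "finite E" "E \<subseteq> Aut L M"
    and f: "finite (f ` Aut L M)"
      "\<And>g x. g \<in> Aut L M \<Longrightarrow> x \<in> Aut L M \<Longrightarrow> \<forall>a\<in>A\<^sub>0. x a = a \<Longrightarrow> f (g \<circ> x) = f g"
  obtains g where "g \<in> Aut L M" "\<And>e e'. e \<in> E \<Longrightarrow> e' \<in> E \<Longrightarrow> f (g \<circ> e) = f (g \<circ> e')"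
proof -
  have Fr: "Fraisse_structure L M" and RC: "Ramsey_class L (age L M)"
    and rigid: "\<forall>N\<in>age L M. rigid L N" using R by (auto simp: Ramsey_structure_def)
  have str: "is_structure L M" and lf: "locally_finite L M"
    using Fr by (auto simp: Fraisse_structure_def)
  define A where "A = subuniverse L M hull A\<^sub>0"
  have A: "subuniverse L M A" "finite A" "A\<^sub>0 \<subseteq> A" "A \<subseteq> univ M"
    using subuniverse_hull[OF str A\<^sub>0(2)] lf A\<^sub>0 hull_subset[of A\<^sub>0]
    by (auto simp: A_def locally_finite_def subuniverse_def)
  \<comment> \<open>If \<open>g\<close> and \<open>g'\<close> map \<open>A\<close> onto the same
    set, then \<open>inv g \<circ> g'\<close> fixes \<open>A\<close> pointwise by rigidity, and
    right invariance of \<open>f\<close> applies.\<close>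
  have f_eq: "f g = f g'" if "g \<in> Aut L M" "g' \<in> Aut L M" "g ` A = g' ` A" for g g'
  proof -
    have bij: "bij g" using Aut_permutes[OF that(1)] by (rule permutes_bij)
    have x: "inv g \<circ> g' \<in> Aut L M" using that str by (intro Aut_comp Aut_inv)
    have "(inv g \<circ> g') ` A = inv g ` g ` A" using that(3) by (metis image_comp)
    also have "\<dots> = A" using bij by (simp add: bij_is_inj image_inv_f_f)
    finally have "(inv g \<circ> g') a = a" if "a \<in> A" for a
      using rigid_setwise_pointwise[OF rigid A(1,2) Aut_embedding[OF x]] that by blast
    then have "f (g \<circ> (inv g \<circ> g')) = f g" using f(2)[OF that(1) x] A(3) by blast
    moreover have "g \<circ> (inv g \<circ> g') = g'"
      using bij by (simp add: fun_eq_iff bij_is_surj surj_f_inv_f)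
    ultimately show ?thesis by simp
  qed
  define B\<^sub>0 where "B\<^sub>0 = A \<union> (\<Union>e\<in>E. e ` A)"
  have "e ` A \<subseteq> univ M" if "e \<in> E" for e
    using that E(2) subuniverse_image[OF Aut_embedding A(1), of e]
    unfolding subuniverse_def by blast
  then have B\<^sub>0: "finite B\<^sub>0" "B\<^sub>0 \<subseteq> univ M" using A E(1) by (auto simp: B\<^sub>0_def)
  define B where "B = subuniverse L M hull B\<^sub>0"
  have B: "subuniverse L M B" "finite B" "B\<^sub>0 \<subseteq> B" "B \<subseteq> univ M"
    using subuniverse_hull[OF str B\<^sub>0(2)] lf B\<^sub>0 hull_subset[of B\<^sub>0]
    by (auto simp: B_def locally_finite_def subuniverse_def)
  obtain N :: "('f, 'r, nat) struct" and h
    where h: "isomorphism L (induced M B) N h" "isomorphism L N (induced M B) (inv_into B h)"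
      and N: "N \<in> age L M"
    using nat_copy[OF B(1,2)] by blast
  define N\<^sub>A where "N\<^sub>A = induced N (h ` A)"
  have AB: "A \<subseteq> B" using B(3) by (auto simp: B\<^sub>0_def)
  have emb: "embedding L (induced M B) N h" using h(1) by (simp add: isomorphism_def)
  have "subuniverse L (induced M B) A" using A(1) AB by (simp add: subuniverse_def)
  then have sub_A: "subuniverse L N (h ` A)" by (rule subuniverse_image[OF emb])
  have iso_A: "isomorphic L (induced M A) N\<^sub>A"
    using embedding_induced[OF emb, of A] AB by (auto simp: isomorphic_def N\<^sub>A_def)
  have iso_A': "isomorphic L N\<^sub>A (induced M A)"
    by (rule isomorphic_sym[OF iso_A]) (use A(1) in \<open>simp add: subuniverse_def\<close>)
  have "substructure L N\<^sub>A N"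
    using sub_A N embedding_inclusion[of "h ` A" N L]
    by (simp add: substructure_def N\<^sub>A_def is_structure_def subuniverse_def age_def)
  \<comment> \<open>\<open>Ramsey_class\<close> speaks of colours below \<open>k\<close>, so the
    finitely many values of \<open>f\<close> are numbered.\<close>
  obtain \<iota> :: "'c \<Rightarrow> nat" and k where \<iota>: "\<iota> ` f ` Aut L M = {i. i < k}" "inj_on \<iota> (f ` Aut L M)"
    using finite_imp_inj_to_nat_seg[OF f(1)] by blast
  from RC N \<open>substructure L N\<^sub>A N\<close> obtain C where C: "C \<in> age L M"
    and ramsey: "\<And>c :: nat set \<Rightarrow> nat. c \<in> copies L C N\<^sub>A \<rightarrow> {..<k} \<Longrightarrow>
      \<exists>B'\<in>copies L C N. c constant_on copies L (induced C B') N\<^sub>A"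
    unfolding Ramsey_class_def by metis
  obtain j where j: "embedding L C M j" and fin_C: "finite (univ C)" using C by (auto simp: age_def)
  \<comment> \<open>By homogeneity, a copy in \<open>C\<close> becomes under \<open>j\<close> a
    translate of the original subuniverse of \<open>M\<close>. This serves for \<open>A\<close>, to
    define the colouring, and for \<open>B\<close>, to find \<open>g\<close>.\<close>
  have transfer: "\<exists>g. g \<in> Aut L M \<and> g ` X = j ` Y"
    if X: "subuniverse L M X" "finite X" and "isomorphic L (induced M X) N'" "Y \<in> copies L C N'"
    for X Y and N' :: "('f, 'r, nat) struct"
  proof -
    have Y: "subuniverse L C Y" "isomorphic L (induced C Y) N'"
      using that(4) by (auto simp: copies_def)
    have "isomorphic L N' (induced C Y)"
      by (rule isomorphic_sym[OF Y(2)]) (use Y(1) in \<open>simp add: subuniverse_def\<close>)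
    moreover have "isomorphic L (induced C Y) (induced M (j ` Y))"
      using embedding_induced[OF j, of Y] Y(1) by (auto simp: isomorphic_def subuniverse_def)
    ultimately have iso: "isomorphic L (induced M X) (induced M (j ` Y))"
      by (rule isomorphic_trans[OF isomorphic_trans[OF that(3)]])
    have "finite (j ` Y)"
      using Y(1) fin_C by (auto simp: subuniverse_def intro: finite_subset)
    then obtain g where "g \<in> Aut L M" "g ` X = j ` Y"
      by (rule homogeneous_image[OF Fr X subuniverse_image[OF j Y(1)] _ iso])
    then show ?thesis by blast
  qed
  define c where "c Y = \<iota> (f (SOME g. g \<in> Aut L M \<and> g ` A = j ` Y))" for Y
  have c: "c Y = \<iota> (f g)" if "g \<in> Aut L M" "g ` A = j ` Y" for g Y
  proof -
    let ?g = "SOME g. g \<in> Aut L M \<and> g ` A = j ` Y"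
    have g: "?g \<in> Aut L M \<and> ?g ` A = j ` Y" by (rule someI[of _ g]) (use that in blast)
    have "f ?g = f g" by (rule f_eq) (use g that in \<open>simp_all only:\<close>)
    then show ?thesis by (simp add: c_def)
  qed
  have "c Y < k" if Y: "Y \<in> copies L C N\<^sub>A" for Y
  proof -
    obtain g where g: "g \<in> Aut L M" "g ` A = j ` Y"
      using transfer[OF A(1,2) iso_A Y] by blast
    then have "c Y \<in> \<iota> ` f ` Aut L M" using c by simp
    then show ?thesis using \<iota>(1) by simp
  qed
  then have "c \<in> copies L C N\<^sub>A \<rightarrow> {..<k}" by simp
  from ramsey[OF this] obtain B' where B': "B' \<in> copies L C N"
    and const: "c constant_on copies L (induced C B') N\<^sub>A" by blast
  have "isomorphic L (induced M B) N" using h(1) by (auto simp: isomorphic_def)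
  from transfer[OF B(1,2) this B'] obtain g where g: "g \<in> Aut L M" "g ` B = j ` B'" by blast
  have cl_B': "fclosed L C B'" "B' \<subseteq> univ C" using B' by (auto simp: copies_def subuniverse_def)
  have copy: "\<exists>Y\<in>copies L (induced C B') N\<^sub>A. c Y = \<iota> (f (g \<circ> e))" if "e \<in> E" for e
  proof -
    have ge: "g \<circ> e \<in> Aut L M" using g(1) E(2) that by (auto intro: Aut_comp)
    have "e ` A \<subseteq> B" using B(3) that by (auto simp: B\<^sub>0_def)
    define K where "K = (g \<circ> e) ` A"
    have K: "K \<subseteq> j ` B'"
      unfolding K_def g(2)[symmetric] using \<open>e ` A \<subseteq> B\<close> by (metis image_comp image_mono)
    define Y where "Y = {y \<in> B'. j y \<in> K}"
    have jY: "j ` Y = K" using K by (auto simp: Y_def)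
    have sub_K: "subuniverse L M K"
      unfolding K_def by (rule subuniverse_image[OF Aut_embedding[OF ge] A(1)])
    have "fint C s xs \<in> Y" if s: "s \<in> fsyms L" "xs \<in> tuples (farity L s) Y" for s xs
    proof -
      have "xs \<in> tuples (farity L s) B'" using s(2) by (auto simp: tuples_def Y_def)
      then have "fint C s xs \<in> B'" "xs \<in> tuples (farity L s) (univ C)"
        using s(1) cl_B' by (auto simp: fclosed_def tuples_def)
      moreover from this have "j (fint C s xs) = fint M s (map j xs)"
        using j s(1) by (simp add: embedding_def)
      moreover have "map j xs \<in> tuples (farity L s) K"
        using s(2) jY by (intro map_tuples[of j Y]) auto
      then have "fint M s (map j xs) \<in> K"
        using sub_K s(1) unfolding subuniverse_def fclosed_def by blast
      ultimately show ?thesis by (simp add: Y_def)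
    qed
    then have cl_Y: "fclosed L C Y" by (simp add: fclosed_def)
    have Y: "Y \<subseteq> B'" "Y \<subseteq> univ C" using cl_B'(2) by (auto simp: Y_def)
    have "isomorphic L (induced C Y) (induced M K)"
      using embedding_induced[OF j Y(2)] unfolding jY isomorphic_def by blast
    moreover have "isomorphic L (induced M A) (induced M K)"
      using embedding_induced[OF Aut_embedding[OF ge] A(4)] unfolding K_def isomorphic_def by blast
    then have "isomorphic L (induced M K) (induced M A)"
      by (rule isomorphic_sym) (use A(1) in \<open>simp add: subuniverse_def\<close>)
    ultimately have "isomorphic L (induced C Y) N\<^sub>A"
      by (rule isomorphic_trans[OF isomorphic_trans iso_A])
    then have "Y \<in> copies L (induced C B') N\<^sub>A"
      using cl_Y Y by (simp add: copies_def subuniverse_def)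
    moreover have "c Y = \<iota> (f (g \<circ> e))" by (rule c[OF ge]) (simp only: jY K_def)
    ultimately show ?thesis by blast
  qed
  show thesis
  proof (rule that[OF g(1)])
    fix e e' assume e: "e \<in> E" "e' \<in> E"
    then have "\<iota> (f (g \<circ> e)) = \<iota> (f (g \<circ> e'))"
      using copy const unfolding constant_on_def by metis
    moreover have "g \<circ> e \<in> Aut L M" "g \<circ> e' \<in> Aut L M" using g(1) E(2) e by (auto intro: Aut_comp)
    ultimately show "f (g \<circ> e) = f (g \<circ> e')" using \<iota>(2) by (meson imageI inj_onD)
  qed
qed

text \<open>\<open>H\<close> is open, as it contains the pointwise stabiliser of the finite set
  \<open>A\<close>. Its colouring is carried to all left cosets with the same finite set of colours,
  so \<open>H\<close> may have infinite index. The element found in the whole group is then moved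
  back into \<open>H\<close>.\<close>

lemma Ramsey_open_subgroup:
  fixes M :: "('f, 'r, 'a) struct" and f :: "('a \<Rightarrow> 'a) \<Rightarrow> 'c"
  assumes R: "Ramsey_structure L M"
    and H: "H \<subseteq> Aut L M" "id \<in> H" "\<And>g h. g \<in> H \<Longrightarrow> h \<in> H \<Longrightarrow> g \<circ> h \<in> H"
      "\<And>g. g \<in> H \<Longrightarrow> inv g \<in> H"
    and A: "finite A" "A \<subseteq> univ M" "\<And>x. x \<in> Aut L M \<Longrightarrow> \<forall>a\<in>A. x a = a \<Longrightarrow> x \<in> H"
    and E: "finite E" "E \<subseteq> H"
    and f: "finite (f ` H)"
      "\<And>g x. g \<in> H \<Longrightarrow> x \<in> Aut L M \<Longrightarrow> \<forall>a\<in>A. x a = a \<Longrightarrow> f (g \<circ> x) = f g"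
  obtains g where "g \<in> H" "\<forall>e\<in>E. f (g \<circ> e) = f g"
proof -
  have str: "is_structure L M"
    using R by (simp add: Ramsey_structure_def Fraisse_structure_def)
  have bij: "bij g" if "g \<in> Aut L M" for g using Aut_permutes[OF that] by (rule permutes_bij)
  have cancel: "g \<circ> (inv g \<circ> h) = h" if "g \<in> Aut L M" for g h :: "'a \<Rightarrow> 'a"
    using bij[OF that] by (simp add: fun_eq_iff bij_is_surj surj_f_inv_f)
  define coset where "coset g = {g \<circ> h | h. h \<in> H}" for g :: "'a \<Rightarrow> 'a"
  define rep where "rep g = (SOME x. x \<in> coset g)" for g
  have coset_eq: "coset (g \<circ> h) = coset g" if "h \<in> H" for g h
  proof (intro equalityI subsetI)
    fix x assume "x \<in> coset (g \<circ> h)"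
    then obtain h' where "h' \<in> H" "x = g \<circ> (h \<circ> h')" by (auto simp: coset_def comp_assoc)
    then show "x \<in> coset g" using H(3) that unfolding coset_def by blast
  next
    fix x assume "x \<in> coset g"
    then obtain h' where h': "h' \<in> H" "x = g \<circ> h'" by (auto simp: coset_def)
    have "x = g \<circ> h \<circ> (inv h \<circ> h')"
      using cancel[of h h'] that H(1) h'(2) by (auto simp: comp_assoc)
    then show "x \<in> coset (g \<circ> h)" using H(3,4) that h'(1) unfolding coset_def by blast
  qed
  have rep: "\<exists>h\<in>H. rep g = g \<circ> h" for g
  proof -
    have "g \<circ> id \<in> coset g" using H(2) unfolding coset_def by blast
    then have "rep g \<in> coset g" unfolding rep_def by (rule someI[of "\<lambda>x. x \<in> coset g"])
    then show ?thesis by (auto simp: coset_def)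
  qed
  have rep_H: "inv (rep g) \<circ> g \<in> H" if "g \<in> Aut L M" for g
  proof -
    obtain h where h: "h \<in> H" "rep g = g \<circ> h" using rep by blast
    have "inv (g \<circ> h) = inv h \<circ> inv g"
      using h(1) H(1) that by (intro o_inv_distrib bij) auto
    then have "inv (rep g) \<circ> g = inv h"
      using bij[OF that] by (simp add: h(2) comp_assoc bij_is_inj)
    then show ?thesis using H(4) h(1) by simp
  qed
  \<comment> \<open>\<open>F\<close> copies \<open>f\<close> to each left coset of \<open>H\<close>; a set on which \<open>F\<close> is constant, of the form
    \<open>g E\<close> with \<open>E \<subseteq> H\<close>, lies in a single coset.\<close>
  define F where "F g = f (inv (rep g) \<circ> g)" for g
  \<comment> \<open>\<open>rep\<close> is constant on cosets, so on the coset of \<open>g\<close>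
    the colouring \<open>F\<close> is \<open>f\<close> translated by one element of
    \<open>H\<close>.\<close>
  have F: "F (g \<circ> h) = f ((inv (rep g) \<circ> g) \<circ> h)" if "h \<in> H" for g h
    using coset_eq[OF that, of g] by (simp add: F_def rep_def comp_assoc)
  have "F ` Aut L M \<subseteq> f ` H" using rep_H by (auto simp: F_def)
  then have "finite (F ` Aut L M)" using f(1) by (rule finite_subset)
  moreover have "F (g \<circ> x) = F g" if "g \<in> Aut L M" "x \<in> Aut L M" "\<forall>a\<in>A. x a = a" for g x
    using F[OF A(3)[OF that(2,3)]] f(2)[OF rep_H[OF that(1)] that(2,3)] by (simp add: F_def)
  \<comment> \<open>Including \<open>id\<close> makes the common colour that of \<open>g\<close>
    itself.\<close>
  moreover have "finite (insert id E)" "insert id E \<subseteq> Aut L M" using E H(1,2) by auto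
  ultimately obtain g where g: "g \<in> Aut L M"
    "\<And>e e'. e \<in> insert id E \<Longrightarrow> e' \<in> insert id E \<Longrightarrow> F (g \<circ> e) = F (g \<circ> e')"
    using Ramsey_Aut[OF R A(1,2), of "insert id E" F] by blast
  show thesis
  proof (rule that[OF rep_H[OF g(1)]], rule ballI)
    fix e assume e: "e \<in> E"
    then have "F (g \<circ> e) = F (g \<circ> id)" using g(2) by blast
    then show "f (inv (rep g) \<circ> g \<circ> e) = f (inv (rep g) \<circ> g)"
      using F[of e g] F[of id g] e E(2) H(2) by auto
  qed
qed

section \<open>Stabilisers of imaginaries\<close>

lemma act_comp: "act (g \<circ> h) w = act g (act h w)"
  by (simp add: act_def image_image)

lemma act_id: "act id w = w"
  by (simp add: act_def)

lemma act_inv_cancel: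
  assumes "g \<in> Aut L M"
  shows "act (inv g) (act g w) = w" "act g (act (inv g) w) = w"
proof -
  have "inv g \<circ> g = id" "g \<circ> inv g = id"
    using Aut_permutes[OF assms] by (auto intro: permutes_inv_o)
  then show "act (inv g) (act g w) = w" "act g (act (inv g) w) = w"
    by (simp_all add: act_comp[symmetric] act_id)
qed

text \<open>Fixing a representative tuple pointwise fixes its class, so stabilisers of imaginaries
  are open.\<close>

lemma meq_support:
  assumes "is_structure L M" "w \<in> meq L M"
  shows "\<exists>A. finite A \<and> A \<subseteq> univ M \<and> (\<forall>x\<in>Aut L M. (\<forall>a\<in>A. x a = a) \<longrightarrow> act x w = w)"
proof -
  obtain n D E where E: "definable_equiv L M n D E" "w \<in> D // E"
    using assms(2) by (auto simp: meq_def)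
  then obtain xs where xs: "xs \<in> D" "w = E `` {xs}" by (auto simp: quotient_def)
  have "D \<subseteq> tuples n (univ M)" using E(1) definable_subset[of L M n D] by (simp add: definable_equiv_def)
  then have "set xs \<subseteq> univ M" using xs(1) by (auto simp: tuples_def)
  show ?thesis
  proof (intro exI[of _ "set xs"] conjI ballI impI)
    fix x assume x: "x \<in> Aut L M" "\<forall>a\<in>set xs. x a = a"
    then have "map x xs = xs" by (simp add: map_idI)
    then show "act x w = w" using act_class[OF assms(1) x(1) E(1) xs(1)] xs(2) by simp
  qed (use \<open>set xs \<subseteq> univ M\<close> in auto)
qed

lemma meq_sort_support:
  assumes "is_structure L M" "meq_sort L M W" "w \<in> W"
  shows "\<exists>A. finite A \<and> A \<subseteq> univ M \<and> (\<forall>x\<in>Aut L M. (\<forall>a\<in>A. x a = a) \<longrightarrow> act x w = w)"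
proof -
  obtain t g where t: "t \<in> meq L M" and g: "g \<in> Aut L M" "w = act g t"
    using assms(2,3) by (auto simp: meq_sort_def meq_orbit_def)
  obtain A where A: "finite A" "A \<subseteq> univ M"
    "\<And>x. x \<in> Aut L M \<Longrightarrow> \<forall>a\<in>A. x a = a \<Longrightarrow> act x t = t"
    using meq_support[OF assms(1) t] by blast
  have perm: "g permutes univ M" by (rule Aut_permutes[OF g(1)])
  show ?thesis
  proof (intro exI[of _ "g ` A"] conjI ballI impI)
    show "finite (g ` A)" using A(1) by simp
    show "g ` A \<subseteq> univ M" using image_mono[OF A(2), of g] permutes_image[OF perm] by simp
    fix x assume x: "x \<in> Aut L M" "\<forall>a\<in>g ` A. x a = a"
    have "inv g \<circ> (x \<circ> g) \<in> Aut L M"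
      by (intro Aut_comp Aut_inv assms(1) g(1) x(1))
    moreover have "\<forall>a\<in>A. (inv g \<circ> (x \<circ> g)) a = a"
      using x(2) permutes_inverses(2)[OF perm] by simp
    ultimately have "act (inv g \<circ> (x \<circ> g)) t = t" by (rule A(3))
    then have "act (inv g) (act x (act g t)) = t" by (simp only: act_comp)
    then have "act g (act (inv g) (act x (act g t))) = act g t" by simp
    then show "act x w = w" by (simp only: act_inv_cancel(2)[OF g(1)] g(2))
  qed
qed

lemma meq_sort_act:
  assumes "meq_sort L M W" "w \<in> W" "g \<in> Aut L M"
  shows "act g w \<in> W"
proof -
  obtain T where T: "W = \<Union> (meq_orbit L M ` T)" using assms(1) by (auto simp: meq_sort_def)
  then obtain t h where t: "t \<in> T" "h \<in> Aut L M" "w = act h t"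
    using assms(2) by (auto simp: meq_orbit_def)
  then have "act g w = act (g \<circ> h) t" by (simp add: act_comp)
  moreover have "g \<circ> h \<in> Aut L M" using assms(3) t(2) by (rule Aut_comp)
  ultimately have "act g w \<in> meq_orbit L M t" unfolding meq_orbit_def by blast
  then show ?thesis using T t(1) by blast
qed

section \<open>Pointwise stabilisers and synchronised colours\<close>

lemma pw_stabiliser_group:
  assumes "is_structure L M"
  shows "pw_stabiliser L M S \<subseteq> Aut L M" "id \<in> pw_stabiliser L M S"
    "\<And>g h. g \<in> pw_stabiliser L M S \<Longrightarrow> h \<in> pw_stabiliser L M S \<Longrightarrow> g \<circ> h \<in> pw_stabiliser L M S"
    "\<And>g. g \<in> pw_stabiliser L M S \<Longrightarrow> inv g \<in> pw_stabiliser L M S"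
proof -
  show "inv g \<in> pw_stabiliser L M S" if "g \<in> pw_stabiliser L M S" for g
  proof -
    have g: "g \<in> Aut L M" "\<And>s. s \<in> S \<Longrightarrow> act g s = s" using that by (auto simp: pw_stabiliser_def)
    have "act (inv g) s = s" if "s \<in> S" for s
      using act_inv_cancel(1)[OF g(1), of s] g(2)[OF that] by simp
    then show ?thesis using Aut_inv[OF assms g(1)] by (simp add: pw_stabiliser_def)
  qed
qed (auto simp: pw_stabiliser_def Aut_id act_id Aut_comp act_comp)

lemma fun_act_inv_apply:
  assumes "g \<in> Aut L M" "w \<in> W"
  shows "fun_act W (inv g) f w = f (act g w)"
proof -
  have "inv (inv g) = g" using Aut_permutes[OF assms(1)] by (intro inv_inv_eq permutes_bij)
  then show ?thesis using assms(2) by (simp add: fun_act_def)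
qed

text \<open>Each pair in \<open>I\<close> has the form \<open>(act e y, y)\<close> with
  \<open>e\<close> in the stabiliser. If replacing \<open>g\<close> by \<open>g \<circ> e\<close>
  does not change the colour of the translate of \<open>y\<close>, then the translates by
  \<open>g\<close> of both members of the pair have equal colours.\<close>

lemma stabiliser_synchronises:
  fixes L :: "('f, 'r) language" and M :: "('f, 'r, 'a) struct" and col :: "'a list set \<Rightarrow> 'c"
  assumes R: "Ramsey_structure L M" and W: "meq_sort L M W"
    and S: "finite S" "S \<subseteq> W" and col: "finite (range col)"
    and I: "finite I" "I \<subseteq> {(act g w, w) | g w. g \<in> pw_stabiliser L M S \<and> w \<in> W}"
  obtains g where "g \<in> pw_stabiliser L M S"
    "\<forall>(x, y)\<in>I. col (act g x) = col (act g y)"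
proof -
  let ?H = "pw_stabiliser L M S"
  have str: "is_structure L M" using R by (simp add: Ramsey_structure_def Fraisse_structure_def)
  note H = pw_stabiliser_group[OF str, where S = S]
  have "\<forall>p\<in>I. \<exists>g. g \<in> ?H \<and> fst p = act g (snd p)"
    by (rule ballI, drule subsetD[OF I(2)]) auto
  then obtain \<gamma> where \<gamma>: "\<forall>p\<in>I. \<gamma> p \<in> ?H \<and> fst p = act (\<gamma> p) (snd p)" by metis
  have "\<forall>w\<in>W. \<exists>A. finite A \<and> A \<subseteq> univ M \<and>
      (\<forall>x\<in>Aut L M. (\<forall>a\<in>A. x a = a) \<longrightarrow> act x w = w)"
    using meq_sort_support[OF str W] by (rule ballI)
  from bchoice[OF this] obtain supp where supp: "\<forall>w\<in>W. finite (supp w) \<and> supp w \<subseteq> univ M \<and>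
      (\<forall>x\<in>Aut L M. (\<forall>a\<in>supp w. x a = a) \<longrightarrow> act x w = w)" by blast
  \<comment> \<open>Supporting \<open>S\<close> places the pointwise stabiliser of \<open>A\<close>
    inside \<open>?H\<close>; supporting the second components makes \<open>f\<close> below
    invariant under it on the right.\<close>
  define K where "K = S \<union> snd ` I"
  have "snd ` I \<subseteq> W" using image_mono[OF I(2), of snd] by force
  then have K: "finite K" "K \<subseteq> W" using S I(1) by (auto simp: K_def)
  define A where "A = (\<Union>w\<in>K. supp w)"
  have A: "finite A" "A \<subseteq> univ M" using K supp by (auto simp: A_def)
  have fix_K: "act x w = w" if "x \<in> Aut L M" "\<forall>a\<in>A. x a = a" "w \<in> K" for x w
  proof -
    have "\<forall>a\<in>supp w. x a = a" using that(2,3) by (simp add: A_def)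
    moreover have "w \<in> W" using that(3) K(2) by blast
    ultimately show ?thesis using bspec[OF supp] that(1) by simp
  qed
  have A_H: "x \<in> ?H" if "x \<in> Aut L M" "\<forall>a\<in>A. x a = a" for x
    using fix_K[OF that] that(1) by (simp add: pw_stabiliser_def K_def)
  \<comment> \<open>All pairs are coloured simultaneously, so that one \<open>g\<close> serves for
    every pair.\<close>
  define f where "f g = (\<lambda>p\<in>I. col (act g (snd p)))" for g
  have "f ` ?H \<subseteq> I \<rightarrow>\<^sub>E range col" by (auto simp: f_def)
  then have fin: "finite (f ` ?H)" using I(1) col finite_PiE finite_subset by metis
  have f_inv: "f (g \<circ> x) = f g" if "g \<in> ?H" "x \<in> Aut L M" "\<forall>a\<in>A. x a = a" for g x
  proof -
    have "act x (snd p) = snd p" if "p \<in> I" for p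
      by (rule fix_K) (use that \<open>x \<in> Aut L M\<close> \<open>\<forall>a\<in>A. x a = a\<close> in \<open>auto simp: K_def\<close>)
    then show ?thesis by (simp add: f_def act_comp cong: restrict_cong)
  qed
  have E: "finite (\<gamma> ` I)" "\<gamma> ` I \<subseteq> ?H" using I(1) \<gamma> by auto
  obtain g where g: "g \<in> ?H" "\<forall>e\<in>\<gamma> ` I. f (g \<circ> e) = f g"
    by (rule Ramsey_open_subgroup[OF R H A A_H E fin f_inv])
  show thesis
  proof (rule that[OF g(1)], clarify)
    fix x y assume p: "(x, y) \<in> I"
    then have x: "x = act (\<gamma> (x, y)) y" using \<gamma> by force
    have "f (g \<circ> \<gamma> (x, y)) (x, y) = f g (x, y)" using g(2) p by simp
    then show "col (act g x) = col (act g y)"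
      using p x by (simp add: f_def act_comp)
  qed
qed

section \<open>Construction of the invariant function from duality and synchronisation\<close>

theorem corollary2p3:
  fixes L :: "('f, 'r) language"
    and M :: "('f, 'r, 'a) struct"
    and W :: "'a list set set"
    and U V :: "('a list set \<Rightarrow> 'k::field) set"
  assumes "omega_categorical L M"
    and "Ramsey_structure L M"
    and "meq_sort L M W"
    and "fun_subspace W U" and "fun_subspace W V"
    and "closedin (pointwise_topology W) U" and "closedin (pointwise_topology W) V"
    and "invariant_set W (Aut L M) U" and "invariant_set W (Aut L M) V"
    and "U \<subset> V"
  shows "\<exists>S h. finite S \<and> S \<subseteq> W \<and> h \<in> V - U \<and> invariant_fun W (pw_stabiliser L M S) h"
proof -
  have str: "is_structure L M" using assms(1) by (simp add: omega_categorical_def)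
  have V_ext: "f \<in> W \<rightarrow>\<^sub>E UNIV" if "f \<in> V" for f
    using assms(5) that by (auto simp: fun_subspace_def)
  obtain v\<^sub>0 where v\<^sub>0: "v\<^sub>0 \<in> V" "v\<^sub>0 \<notin> U" using assms(10) by blast
  obtain S a where S: "finite S" "S \<subseteq> W"
    and a: "\<And>u. u \<in> U \<Longrightarrow> (\<Sum>s\<in>S. a s * u s) = 0" "(\<Sum>s\<in>S. a s * v\<^sub>0 s) = 1"
    by (rule closed_subspace_separation[OF assms(4,6) V_ext[OF v\<^sub>0(1)] v\<^sub>0(2)]) blast
  let ?H = "pw_stabiliser L M S"
  note H = pw_stabiliser_group[OF str, where S = S]
  \<comment> \<open>Taking equal values on all these pairs is the same as invariance under
    \<open>?H\<close>, for functions in \<open>V\<close>.\<close>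
  define P where "P = {(act g w, w) | g w. g \<in> ?H \<and> w \<in> W}"
  have P: "P \<subseteq> W \<times> W" using H(1) meq_sort_act[OF assms(3)] by (auto simp: P_def)
  \<comment> \<open>A translate of \<open>v\<^sub>0\<close> by an element of \<open>?H\<close>
    refutes the relation: its pairing with \<open>a\<close> remains \<open>1\<close>, while the
    colouring keeps the right-hand side away from \<open>1\<close>.\<close>
  have "\<exists>v\<in>V. (\<Sum>s\<in>S. a s * v s) \<noteq> (\<Sum>p\<in>I. c p * (v (fst p) - v (snd p)))"
    if I: "finite I" "I \<subseteq> P" for I c
  proof -
    obtain \<kappa> :: "'k \<Rightarrow> 'a list set \<times> 'a list set \<Rightarrow> int" where \<kappa>: "finite (range \<kappa>)"
      "\<forall>x y. (\<forall>p\<in>I. \<kappa> (x p) = \<kappa> (y p)) \<longrightarrow> (\<Sum>p\<in>I. c p * (x p - y p)) \<noteq> 1"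
      by (rule Straus_colouring[OF I(1) one_neq_zero, where c = c])
    have "finite (range (\<kappa> \<circ> v\<^sub>0))" by (rule finite_subset[OF _ \<kappa>(1)]) auto
    then obtain g where g: "g \<in> ?H"
      "\<forall>(x, y)\<in>I. (\<kappa> \<circ> v\<^sub>0) (act g x) = (\<kappa> \<circ> v\<^sub>0) (act g y)"
      by (rule stabiliser_synchronises[OF assms(2,3) S _ I[unfolded P_def]])
    have gA: "g \<in> Aut L M" using g(1) H(1) by blast
    \<comment> \<open>\<open>fun_act\<close> inverts the group element, so acting by
      \<open>inv g\<close> yields the values \<open>v\<^sub>0 (act g w)\<close>.\<close>
    define v where "v = fun_act W (inv g) v\<^sub>0"
    have v: "v w = v\<^sub>0 (act g w)" if "w \<in> W" for w
      unfolding v_def by (rule fun_act_inv_apply[OF gA that])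
    have "(\<Sum>p\<in>I. c p * (v (fst p) - v (snd p))) \<noteq> 1"
    proof (rule \<kappa>(2)[rule_format])
      fix p assume p: "p \<in> I"
      then have "fst p \<in> W" "snd p \<in> W" using I(2) P by auto
      then show "\<kappa> (v (fst p)) = \<kappa> (v (snd p))" using g(2) p v by auto
    qed
    moreover have "v \<in> V"
      using assms(9) v\<^sub>0(1) Aut_inv[OF str gA] by (simp add: invariant_set_def v_def)
    moreover have "(\<Sum>s\<in>S. a s * v s) = (\<Sum>s\<in>S. a s * v\<^sub>0 s)"
    proof (rule sum.cong)
      fix s assume s: "s \<in> S"
      then have "act g s = s" using g(1) by (simp add: pw_stabiliser_def)
      then show "a s * v s = a s * v\<^sub>0 s" using v s S(2) by auto
    qed simp
    ultimately show ?thesis unfolding a(2) by (intro bexI[of _ v]) (metis, assumption)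
  qed
  then obtain h where h: "h \<in> V" "(\<Sum>s\<in>S. a s * h s) = 1" "\<forall>(x, y)\<in>P. h x = h y"
    by (rule function_with_identifications[OF assms(5,7) S P])
  have "fun_act W g h = h" if "g \<in> ?H" for g
  proof
    fix w
    show "fun_act W g h w = h w"
    proof (cases "w \<in> W")
      case True
      then have "(act (inv g) w, w) \<in> P" using H(4)[OF that]
        unfolding P_def by (intro CollectI exI[of _ "inv g"] exI[of _ w] conjI refl)
      from bspec[OF h(3) this] show ?thesis using True by (simp add: fun_act_def)
    next
      case False
      then show ?thesis using PiE_arb[OF V_ext[OF h(1)] False] by (simp add: fun_act_def)
    qed
  qed
  then have "invariant_fun W ?H h" by (simp add: invariant_fun_def)
  moreover have "h \<notin> U" using a(1)[of h] h(2) by auto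
  ultimately show ?thesis using S h(1) by blast
qed

end
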